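(* Suppose that the convergence assumption, the source condition and the non-empty interior assumption (all stated in the context) hold. Let $(\lambda_n,\mu_n)$ be a solution of the dual problem $$\max_{\lambda\geq0,\ \mu\geq0}\ (\mu,-\phi_n)\quad\text{s.t. }\lambda-B_n^*\mu\in\partial\mathcal J(0).$$ Then there exists a constant $\tilde C\geq C_0$ (independent of $n$) such that $$\|\mu_n\|_1\leq\tilde C\,\|\bar\mu\|_1 ,$$ where $C_0$ is the constant from the convergence assumption and $\bar\mu$ is the element from the source condition.
   Context: $\Omega\subset\mathbb R^m$ is a bounded domain, $L^1=L^1(\Omega)$, $L^\infty=L^\infty(\Omega)$, $\mathbf 1$ is the constant function one, and $(\cdot,\cdot)$ denotes duality pairings (between $L^1$ and $L^\infty$, and between $L^\infty$ and $(L^\infty)^*$). Functions are ordered a.e. pointwise; for regular linear operators $L^1\to L^\infty$ (differences of two positive operators), $S\geq T$ means that $(S-T)u\geq0$ for all $u\geq 0$; $\mu\in(L^\infty)^*$ satisfies $\mu\geq0$ iff $(\mu,\psi)\geq0$ for all $0\leq\psi\in L^\infty$; pairs are ordered componentwise and an inequality between a pair and a scalar function is meant componentwise. $\|\mu\|_1$ denotes the norm of $\mu\in(L^\infty)^*$ (or $(L^\infty)^*\times(L^\infty)^*$), so $\|\mu\|_1=(\mu,\mathbf 1)$ for $\mu\geq0$. $A\colon L^1\to L^\infty$ is a linear operator and $f\in L^\infty$. Sequences of bounds satisfy $f^l_n\leq f\leq f^u_n$, $f^l_{n+1}\geq f^l_n$, $f^u_{n+1}\leq f^u_n$, $A^l_n\leq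 A\leq A^u_n$, $A^l_{n+1}\geq A^l_n$, $A^u_{n+1}\leq A^u_n$, $\|f^u_n-f^l_n\|_\infty\to0$, $\|A^u_n-A^l_n\|\to0$. Put $B_nu=(A^l_nu,-A^u_nu)$, $\phi_n=(f^u_n,-f^l_n)$, $\bar Bu=(Au,-Au)$, $\bar\phi=(f,-f)$. In dual problems $\lambda\in L^\infty$, $\mu\in(L^\infty)^*\times(L^\infty)^*$, and $B_n^*,\bar B^*\colon(L^\infty)^*\times(L^\infty)^*\to L^\infty$ are the adjoints. $\mathcal J\colon L^1\to[0,\infty]$ is convex, proper and absolutely one-homogeneous. $\partial\mathcal J(u)=\{p\in L^\infty:\ \mathcal J(v)\geq(p,v)\ \forall v\in L^1,\ \mathcal J(u)=(p,u)\}$, so $\partial\mathcal J(0)=\{p\in L^\infty:\mathcal J(v)\geq(p,v)\ \forall v\in L^1\}$. Standing assumption: $Au=f$ has a non-negative solution with finite $\mathcal J$, and $\bar u_{\mathcal J}$ denotes a $\mathcal J$-minimising solution, i.e. a minimiser of $\mathcal J(u)$ over $u\in L^1$, $u\geq0$, $Au=f$. Convergence assumption: there are sequences $\varepsilon_n\downarrow0$, $\eta_n\downarrow0$ and constants $C_0\geq1$, $D_0>0$ with $\varepsilon_n\mathbf 1\leq\phi_n-\bar\phi\leq C_0\varepsilon_n\mathbf 1$, $\|\bar B-B_n\|_{L^1\to L^\infty}\leq\eta_n$, and $\limsup_{n\to\infty}\eta_n/\varepsilon_n\leq D_0$. Source condition: there exists $\bar\mu\in(L^\infty)^*\times(L^\infty)^*$,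 $\bar\mu\geq0$, with $-\bar B^*\bar\mu\in\partial\mathcal J(\bar u_{\mathcal J})$. Non-empty interior assumption: $0$ is an interior point of $\partial\mathcal J(0)$ in the norm topology of $L^\infty$. *)

theory Defs
  imports "HOL-Analysis.Analysis" "HOL-Probability.Essential_Supremum"
begin

text \<open>
  Elements of the spaces \<open>L\<^sup>1\<close> and \<open>L\<^sup>\<infinity>\<close> over a measure space \<open>M\<close> are given by representatives:
  functions \<open>'a \<Rightarrow> real\<close>, with equality and order read almost everywhere.
  Operators and functionals acting on them are required to respect equality a.e.
  The measure space of interest is \<open>lebesgue_on \<Omega>\<close>.
\<close>

type_synonym 'a rfun = "'a \<Rightarrow> real"

definition ae_le :: "'a measure \<Rightarrow> 'a rfun \<Rightarrow> 'a rfun \<Rightarrow> bool" where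
  "ae_le M u v \<longleftrightarrow> (AE x in M. u x \<le> v x)"

definition ae_eq :: "'a measure \<Rightarrow> 'a rfun \<Rightarrow> 'a rfun \<Rightarrow> bool" where
  "ae_eq M u v \<longleftrightarrow> (AE x in M. u x = v x)"

definition ae_pair_le :: "'a measure \<Rightarrow> 'a rfun \<times> 'a rfun \<Rightarrow> 'a rfun \<times> 'a rfun \<Rightarrow> bool" where
  "ae_pair_le M \<phi> \<psi> \<longleftrightarrow> ae_le M (fst \<phi>) (fst \<psi>) \<and> ae_le M (snd \<phi>) (snd \<psi>)"

definition L1 :: "'a measure \<Rightarrow> 'a rfun set" where
  "L1 M = {u. integrable M u}"

definition L1_norm :: "'a measure \<Rightarrow> 'a rfun \<Rightarrow> real" where
  "L1_norm M u = (LINT x|M. \<bar>u x\<bar>)"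

definition Linf :: "'a measure \<Rightarrow> 'a rfun set" where
  "Linf M = {f \<in> borel_measurable M. esssup M (\<lambda>x. ereal \<bar>f x\<bar>) < \<infinity>}"

definition Linf_norm :: "'a measure \<Rightarrow> 'a rfun \<Rightarrow> real" where
  "Linf_norm M f = real_of_ereal (esssup M (\<lambda>x. ereal \<bar>f x\<bar>))"

definition Linf_pair_norm :: "'a measure \<Rightarrow> 'a rfun \<times> 'a rfun \<Rightarrow> real" where
  "Linf_pair_norm M \<phi> = max (Linf_norm M (fst \<phi>)) (Linf_norm M (snd \<phi>))"

definition pairing :: "'a measure \<Rightarrow> 'a rfun \<Rightarrow> 'a rfun \<Rightarrow> real" where
  "pairing M p u = (LINT x|M. p x * u x)"

text \<open>
  The dual of \<open>L\<^sup>\<infinity>\<close>.  Boundedness together with linearity forces such functionals to respect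
  equality a.e.; their values outside of \<open>Linf M\<close> are irrelevant.
\<close>

definition Linf_dual :: "'a measure \<Rightarrow> ('a rfun \<Rightarrow> real) set" where
  "Linf_dual M = {\<mu>.
     (\<forall>\<phi>\<in>Linf M. \<forall>\<psi>\<in>Linf M. \<mu> (\<lambda>x. \<phi> x + \<psi> x) = \<mu> \<phi> + \<mu> \<psi>) \<and>
     (\<forall>c. \<forall>\<psi>\<in>Linf M. \<mu> (\<lambda>x. c * \<psi> x) = c * \<mu> \<psi>) \<and>
     (\<exists>K. \<forall>\<psi>\<in>Linf M. \<bar>\<mu> \<psi>\<bar> \<le> K * Linf_norm M \<psi>)}"

definition dual_norm :: "'a measure \<Rightarrow> ('a rfun \<Rightarrow> real) \<Rightarrow> real" where
  "dual_norm M \<mu> = (SUP \<psi>\<in>{\<psi> \<in> Linf M. Linf_norm M \<psi> \<le> 1}. \<bar>\<mu> \<psi>\<bar>)"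

definition dual_nonneg :: "'a measure \<Rightarrow> ('a rfun \<Rightarrow> real) \<Rightarrow> bool" where
  "dual_nonneg M \<mu> \<longleftrightarrow> (\<forall>\<psi>\<in>Linf M. ae_le M (\<lambda>_. 0) \<psi> \<longrightarrow> 0 \<le> \<mu> \<psi>)"

type_synonym 'a dual_pair = "('a rfun \<Rightarrow> real) \<times> ('a rfun \<Rightarrow> real)"

definition Linf_dual_pair :: "'a measure \<Rightarrow> 'a dual_pair set" where
  "Linf_dual_pair M = Linf_dual M \<times> Linf_dual M"

definition dual_pairing :: "'a dual_pair \<Rightarrow> 'a rfun \<times> 'a rfun \<Rightarrow> real" where
  "dual_pairing \<mu> \<psi> = fst \<mu> (fst \<psi>) + snd \<mu> (snd \<psi>)"

text \<open>The norm dual to \<open>Linf_pair_norm\<close>.\<close>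

definition dual_pair_norm :: "'a measure \<Rightarrow> 'a dual_pair \<Rightarrow> real" where
  "dual_pair_norm M \<mu> = dual_norm M (fst \<mu>) + dual_norm M (snd \<mu>)"

definition dual_pair_nonneg :: "'a measure \<Rightarrow> 'a dual_pair \<Rightarrow> bool" where
  "dual_pair_nonneg M \<mu> \<longleftrightarrow> dual_nonneg M (fst \<mu>) \<and> dual_nonneg M (snd \<mu>)"

definition linear_op :: "'a measure \<Rightarrow> ('a rfun \<Rightarrow> 'a rfun) \<Rightarrow> bool" where
  "linear_op M S \<longleftrightarrow>
     (\<forall>u\<in>L1 M. S u \<in> Linf M) \<and>
     (\<forall>u\<in>L1 M. \<forall>v\<in>L1 M. ae_eq M u v \<longrightarrow> ae_eq M (S u) (S v)) \<and>
     (\<forall>u\<in>L1 M. \<forall>v\<in>L1 M. ae_eq M (S (\<lambda>x. u x + v x)) (\<lambda>x. S u x + S v x)) \<and>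
     (\<forall>c. \<forall>u\<in>L1 M. ae_eq M (S (\<lambda>x. c * u x)) (\<lambda>x. c * S u x))"

definition positive_op :: "'a measure \<Rightarrow> ('a rfun \<Rightarrow> 'a rfun) \<Rightarrow> bool" where
  "positive_op M S \<longleftrightarrow> linear_op M S \<and>
     (\<forall>u\<in>L1 M. ae_le M (\<lambda>_. 0) u \<longrightarrow> ae_le M (\<lambda>_. 0) (S u))"

definition regular_op :: "'a measure \<Rightarrow> ('a rfun \<Rightarrow> 'a rfun) \<Rightarrow> bool" where
  "regular_op M S \<longleftrightarrow> linear_op M S \<and>
     (\<exists>P Q. positive_op M P \<and> positive_op M Q \<and> (\<forall>u\<in>L1 M. ae_eq M (S u) (P u - Q u)))"

definition op_le :: "'a measure \<Rightarrow> ('a rfun \<Rightarrow> 'a rfun) \<Rightarrow> ('a rfun \<Rightarrow> 'a rfun) \<Rightarrow> bool" where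
  "op_le M T S \<longleftrightarrow> (\<forall>u\<in>L1 M. ae_le M (\<lambda>_. 0) u \<longrightarrow> ae_le M (\<lambda>_. 0) (S u - T u))"

text \<open>
  Operator norm with respect to a norm \<open>N\<close> on the target space.  It is extended-real-valued, so
  that it is \<open>\<infinity>\<close> (and not an unspecified real number) for unbounded operators.
\<close>

definition op_norm :: "'a measure \<Rightarrow> ('b \<Rightarrow> real) \<Rightarrow> ('a rfun \<Rightarrow> 'b) \<Rightarrow> ereal" where
  "op_norm M N S = (SUP u\<in>{u \<in> L1 M. L1_norm M u \<le> 1}. ereal (N (S u)))"

text \<open>
  \<open>B\<^sub>n\<close> is \<open>constraint_op (Al n) (Au n)\<close> and \<open>\<phi>\<^sub>n\<close> is \<open>constraint_data (fl n) (fu n)\<close>; the limits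
  \<open>B\<close>-bar and \<open>\<phi>\<close>-bar are \<open>constraint_op A A\<close> and \<open>constraint_data f f\<close>.
\<close>

definition constraint_op ::
    "('a rfun \<Rightarrow> 'a rfun) \<Rightarrow> ('a rfun \<Rightarrow> 'a rfun) \<Rightarrow> 'a rfun \<Rightarrow> 'a rfun \<times> 'a rfun" where
  "constraint_op Al Au u = (Al u, - Au u)"

definition constraint_data :: "'a rfun \<Rightarrow> 'a rfun \<Rightarrow> 'a rfun \<times> 'a rfun" where
  "constraint_data fl fu = (fu, - fl)"

text \<open>
  The adjoint is unique only up to equality a.e., hence a choice of a representative; for bounded
  \<open>B\<close> on a sigma-finite measure space it exists because \<open>(L\<^sup>1)\<^sup>* = L\<^sup>\<infinity>\<close>.
\<close>

definition adjoint_op ::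
    "'a measure \<Rightarrow> ('a rfun \<Rightarrow> 'a rfun \<times> 'a rfun) \<Rightarrow> 'a dual_pair \<Rightarrow> 'a rfun" where
  "adjoint_op M B \<mu> =
     (SOME q. q \<in> Linf M \<and> (\<forall>v\<in>L1 M. pairing M q v = dual_pairing \<mu> (B v)))"

definition L1_functional :: "'a measure \<Rightarrow> ('a rfun \<Rightarrow> ereal) \<Rightarrow> bool" where
  "L1_functional M J \<longleftrightarrow> (\<forall>u\<in>L1 M. 0 \<le> J u) \<and>
     (\<forall>u\<in>L1 M. \<forall>v\<in>L1 M. ae_eq M u v \<longrightarrow> J u = J v)"

definition convex_functional :: "'a measure \<Rightarrow> ('a rfun \<Rightarrow> ereal) \<Rightarrow> bool" where
  "convex_functional M J \<longleftrightarrow> (\<forall>u\<in>L1 M. \<forall>v\<in>L1 M. \<forall>t. 0 < t \<and> t < 1 \<longrightarrow>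
     J (\<lambda>x. (1 - t) * u x + t * v x) \<le> ereal (1 - t) * J u + ereal t * J v)"

definition proper_functional :: "'a measure \<Rightarrow> ('a rfun \<Rightarrow> ereal) \<Rightarrow> bool" where
  "proper_functional M J \<longleftrightarrow> (\<exists>u\<in>L1 M. J u < \<infinity>)"

text \<open>For \<open>c = 0\<close> this says \<open>J 0 = 0\<close>, since \<open>0 * \<infinity> = 0\<close> in \<open>ereal\<close>.\<close>

definition abs_one_homogeneous :: "'a measure \<Rightarrow> ('a rfun \<Rightarrow> ereal) \<Rightarrow> bool" where
  "abs_one_homogeneous M J \<longleftrightarrow> (\<forall>u\<in>L1 M. \<forall>c::real. J (\<lambda>x. c * u x) = ereal \<bar>c\<bar> * J u)"

definition subdiff :: "'a measure \<Rightarrow> ('a rfun \<Rightarrow> ereal) \<Rightarrow> 'a rfun \<Rightarrow> 'a rfun set" where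
  "subdiff M J u =
     {p \<in> Linf M. (\<forall>v\<in>L1 M. ereal (pairing M p v) \<le> J v) \<and> J u = ereal (pairing M p u)}"

definition Linf_interior_point :: "'a measure \<Rightarrow> 'a rfun set \<Rightarrow> 'a rfun \<Rightarrow> bool" where
  "Linf_interior_point M X p \<longleftrightarrow> p \<in> Linf M \<and>
     (\<exists>r>0. \<forall>q\<in>Linf M. Linf_norm M (q - p) < r \<longrightarrow> q \<in> X)"

definition nonneg_solutions ::
    "'a measure \<Rightarrow> ('a rfun \<Rightarrow> 'a rfun) \<Rightarrow> 'a rfun \<Rightarrow> 'a rfun set" where
  "nonneg_solutions M A f = {u \<in> L1 M. ae_le M (\<lambda>_. 0) u \<and> ae_eq M (A u) f}"

definition J_minimising_solution ::
    "'a measure \<Rightarrow> ('a rfun \<Rightarrow> 'a rfun) \<Rightarrow> 'a rfun \<Rightarrow> ('a rfun \<Rightarrow> ereal) \<Rightarrow> 'a rfun \<Rightarrow> bool" where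
  "J_minimising_solution M A f J u \<longleftrightarrow> u \<in> nonneg_solutions M A f \<and>
     (\<forall>v\<in>nonneg_solutions M A f. J u \<le> J v)"

definition dual_feasible ::
    "'a measure \<Rightarrow> ('a rfun \<Rightarrow> ereal) \<Rightarrow> ('a rfun \<Rightarrow> 'a rfun \<times> 'a rfun) \<Rightarrow>
     ('a rfun \<times> 'a dual_pair) set" where
  "dual_feasible M J B = {(lam, \<mu>). lam \<in> Linf M \<and> \<mu> \<in> Linf_dual_pair M \<and>
     ae_le M (\<lambda>_. 0) lam \<and> dual_pair_nonneg M \<mu> \<and>
     lam - adjoint_op M B \<mu> \<in> subdiff M J (\<lambda>_. 0)}"

definition dual_solution ::
    "'a measure \<Rightarrow> ('a rfun \<Rightarrow> ereal) \<Rightarrow> ('a rfun \<Rightarrow> 'a rfun \<times> 'a rfun) \<Rightarrow> 'a rfun \<times> 'a rfun \<Rightarrow>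
     'a rfun \<Rightarrow> 'a dual_pair \<Rightarrow> bool" where
  "dual_solution M J B \<phi> lam \<mu> \<longleftrightarrow> (lam, \<mu>) \<in> dual_feasible M J B \<and>
     (\<forall>(lam', \<nu>)\<in>dual_feasible M J B. dual_pairing \<nu> (- \<phi>) \<le> dual_pairing \<mu> (- \<phi>))"

end

theory Submission
  imports Defs
begin

text \<open>
  Write \<open>(\<mu>, \<phi>)\<close> for the dual pairing, \<open>B\<close> for the exact operator pair, \<open>B\<^sub>n\<close> and \<open>\<phi>\<^sub>n\<close> for the
  approximate operators and data, \<open>\<phi>\<close> for the exact data, \<open>\<nu>\<close> for the source element and
  \<open>j\<close> for the value of \<open>J\<close> at the \<open>J\<close>-minimising solution \<open>u\<close>.  For nonnegative functionals the
  norm is the value at the constant one, so the data bounds give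
  \<open>\<epsilon>\<^sub>n \<parallel>\<mu>\<parallel> \<le> (\<mu>, \<phi>\<^sub>n) - (\<mu>, \<phi>) \<le> C0 \<epsilon>\<^sub>n \<parallel>\<mu>\<parallel>\<close> for every \<open>\<mu> \<ge> 0\<close>.

  Since \<open>\<phi> = B u\<close>, the source condition says \<open>(\<nu>, \<phi>) = - j\<close>.  Since \<open>u \<ge> 0\<close> and \<open>B\<^sub>n u \<le> B u\<close>,
  every dual feasible \<open>\<mu>\<close> satisfies \<open>(\<mu>, \<phi>) \<ge> - j\<close>.  If \<open>\<nu>\<close> were feasible for the \<open>n\<close>-th dual
  problem, optimality of \<open>\<mu>\<^sub>n\<close> would give \<open>\<parallel>\<mu>\<^sub>n\<parallel> \<le> C0 \<parallel>\<nu>\<parallel>\<close> at once.  It need not be feasible, because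
  \<open>- B\<^sub>n\<^sup>* \<nu>\<close> differs from a subgradient by a perturbation of size \<open>\<eta>\<^sub>n \<parallel>\<nu>\<parallel>\<close>.  But \<open>0\<close> is interior
  to the set of subgradients at \<open>0\<close>, that is, \<open>J v \<ge> s \<parallel>v\<parallel>\<^sub>1\<close> for some \<open>s > 0\<close>
  (\<open>coercive_of_interior\<close>), and this makes the multiple \<open>c \<nu>\<close> feasible for
  \<open>c = s / (s + \<eta>\<^sub>n \<parallel>\<nu>\<parallel>)\<close> (\<open>scale_dual_feasible\<close>).  The loss \<open>1 - c\<close> is of order \<open>\<eta>\<^sub>n\<close>, hence of
  order \<open>\<epsilon>\<^sub>n\<close>, and costs only the additional term \<open>(j / s) (\<eta>\<^sub>n / \<epsilon>\<^sub>n)\<close> in the constant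
  (\<open>dual_solution_norm_le\<close>).

  These computations use the adjoint through its duality relation, so a representing function in
  \<open>L\<^sup>\<infinity>\<close> has to exist.  The functional \<open>v \<mapsto> (\<mu>, B\<^sub>n v)\<close> is a difference of positive functionals on
  \<open>L\<^sup>1\<close>; such functionals are automatically bounded and are represented by a Radon-Nikodym
  density (\<open>positive_L1_functional.representation\<close>).
\<close>

section \<open>Integrable and essentially bounded functions\<close>

lemma L1_add: "u \<in> L1 M \<Longrightarrow> v \<in> L1 M \<Longrightarrow> (\<lambda>x. u x + v x) \<in> L1 M"
  and L1_diff: "u \<in> L1 M \<Longrightarrow> v \<in> L1 M \<Longrightarrow> (\<lambda>x. u x - v x) \<in> L1 M"
  and L1_scale: "u \<in> L1 M \<Longrightarrow> (\<lambda>x. c * u x) \<in> L1 M"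
  and L1_abs: "u \<in> L1 M \<Longrightarrow> (\<lambda>x. \<bar>u x\<bar>) \<in> L1 M"
  by (auto simp: L1_def)

lemma Linf_iff_AE_bounded:
  "g \<in> Linf M \<longleftrightarrow> g \<in> borel_measurable M \<and> (\<exists>C. AE x in M. \<bar>g x\<bar> \<le> C)"
proof
  assume g: "g \<in> Linf M"
  then have m: "g \<in> borel_measurable M" and fin: "esssup M (\<lambda>x. ereal \<bar>g x\<bar>) < \<infinity>"
    by (auto simp: Linf_def)
  from fin obtain C where C: "esssup M (\<lambda>x. ereal \<bar>g x\<bar>) \<le> ereal C"
    by (cases "esssup M (\<lambda>x. ereal \<bar>g x\<bar>)") auto
  have "AE x in M. \<bar>g x\<bar> \<le> C"
    using esssup_AE[of "\<lambda>x. ereal \<bar>g x\<bar>" M]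
  proof eventually_elim
    case (elim x)
    from order_trans[OF elim C] show ?case by simp
  qed
  with m show "g \<in> borel_measurable M \<and> (\<exists>C. AE x in M. \<bar>g x\<bar> \<le> C)" by blast
next
  assume "g \<in> borel_measurable M \<and> (\<exists>C. AE x in M. \<bar>g x\<bar> \<le> C)"
  then obtain C where m: "g \<in> borel_measurable M" and C: "AE x in M. \<bar>g x\<bar> \<le> C" by blast
  have "esssup M (\<lambda>x. ereal \<bar>g x\<bar>) \<le> ereal C"
    by (rule esssup_I) (use m C in auto)
  with m show "g \<in> Linf M" by (auto simp: Linf_def intro: le_less_trans)
qed

lemma AE_abs_le_Linf_norm:
  assumes "g \<in> Linf M"
  shows "AE x in M. \<bar>g x\<bar> \<le> Linf_norm M g"
  using esssup_AE[of "\<lambda>x. ereal \<bar>g x\<bar>" M] assms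
  by (cases "esssup M (\<lambda>x. ereal \<bar>g x\<bar>)") (auto simp: Linf_def Linf_norm_def elim!: eventually_mono)

lemma Linf_norm_le:
  assumes "g \<in> borel_measurable M" "AE x in M. \<bar>g x\<bar> \<le> C" "0 \<le> C"
  shows "Linf_norm M g \<le> C"
proof -
  have "esssup M (\<lambda>x. ereal \<bar>g x\<bar>) \<le> ereal C"
    by (rule esssup_I) (use assms in auto)
  then show ?thesis
    using assms(3) unfolding Linf_norm_def
    by (cases "esssup M (\<lambda>x. ereal \<bar>g x\<bar>)") auto
qed

lemma Linf_const: "(\<lambda>_. c) \<in> Linf M"
  by (auto simp: Linf_iff_AE_bounded)

lemma Linf_add:
  assumes "g \<in> Linf M" "h \<in> Linf M"
  shows "(\<lambda>x. g x + h x) \<in> Linf M"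
proof -
  from assms obtain C D where "AE x in M. \<bar>g x\<bar> \<le> C" "AE x in M. \<bar>h x\<bar> \<le> D"
    by (auto simp: Linf_iff_AE_bounded)
  then have "AE x in M. \<bar>g x + h x\<bar> \<le> C + D" by eventually_elim auto
  with assms show ?thesis by (auto simp: Linf_iff_AE_bounded)
qed

lemma Linf_scale:
  assumes "g \<in> Linf M"
  shows "(\<lambda>x. c * g x) \<in> Linf M"
proof -
  from assms obtain C where "AE x in M. \<bar>g x\<bar> \<le> C"
    by (auto simp: Linf_iff_AE_bounded)
  then have "AE x in M. \<bar>c * g x\<bar> \<le> \<bar>c\<bar> * C"
    by eventually_elim (auto simp: abs_mult intro: mult_left_mono)
  with assms show ?thesis by (auto simp: Linf_iff_AE_bounded)
qed

lemma Linf_diff: "g \<in> Linf M \<Longrightarrow> h \<in> Linf M \<Longrightarrow> (\<lambda>x. g x - h x) \<in> Linf M"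
  using Linf_add[of g M "\<lambda>x. -1 * h x"] Linf_scale[of h M "-1"] by simp

lemma Linf_uminus: "g \<in> Linf M \<Longrightarrow> (\<lambda>x. - g x) \<in> Linf M"
  using Linf_scale[of g M "-1"] by simp

lemma integrable_Linf_mult_L1:
  assumes "q \<in> Linf M" "v \<in> L1 M"
  shows "integrable M (\<lambda>x. q x * v x)"
proof -
  from assms obtain C where C: "AE x in M. \<bar>q x\<bar> \<le> C" and [measurable]: "q \<in> borel_measurable M"
    by (auto simp: Linf_iff_AE_bounded)
  have v: "integrable M v" using assms by (simp add: L1_def)
  then have [measurable]: "v \<in> borel_measurable M" by auto
  have "AE x in M. norm (q x * v x) \<le> norm (C * \<bar>v x\<bar>)"
    using C by eventually_elim (auto simp: abs_mult intro!: mult_right_mono)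
  moreover have "integrable M (\<lambda>x. C * \<bar>v x\<bar>)" using v by simp
  moreover have "(\<lambda>x. q x * v x) \<in> borel_measurable M" by measurable
  ultimately show ?thesis
    using Bochner_Integration.integrable_bound by blast
qed

lemma pairing_diff_left:
  "p \<in> Linf M \<Longrightarrow> q \<in> Linf M \<Longrightarrow> v \<in> L1 M \<Longrightarrow>
    pairing M (\<lambda>x. p x - q x) v = pairing M p v - pairing M q v"
  by (simp add: pairing_def left_diff_distrib integrable_Linf_mult_L1)

section \<open>Positive functionals on \<open>L\<^sup>1\<close>\<close>

text \<open>
  Functionals are given on representatives.  Positivity is read a.e., and this makes them respect
  equality a.e., through monotonicity in both directions.
\<close>

locale positive_L1_functional = finite_measure M for M :: "'a measure" +
  fixes \<psi> :: "'a rfun \<Rightarrow> real"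
  assumes add: "u \<in> L1 M \<Longrightarrow> v \<in> L1 M \<Longrightarrow> \<psi> (\<lambda>x. u x + v x) = \<psi> u + \<psi> v"
    and scale: "u \<in> L1 M \<Longrightarrow> \<psi> (\<lambda>x. c * u x) = c * \<psi> u"
    and nonneg: "u \<in> L1 M \<Longrightarrow> ae_le M (\<lambda>_. 0) u \<Longrightarrow> 0 \<le> \<psi> u"
begin

lemma diff: "u \<in> L1 M \<Longrightarrow> v \<in> L1 M \<Longrightarrow> \<psi> (\<lambda>x. u x - v x) = \<psi> u - \<psi> v"
  using add[of u "\<lambda>x. -1 * v x"] scale[of v "-1"] L1_scale[of v M "-1"] by simp

lemma mono:
  assumes "u \<in> L1 M" "v \<in> L1 M" "ae_le M u v"
  shows "\<psi> u \<le> \<psi> v"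
proof -
  have "0 \<le> \<psi> (\<lambda>x. v x - u x)"
    using assms by (intro nonneg L1_diff) (auto simp: ae_le_def)
  then show ?thesis using diff[OF assms(2,1)] by simp
qed

lemma zero: "\<psi> (\<lambda>_. 0) = 0"
  using scale[of "\<lambda>_. 0" 0] by (simp add: L1_def)

lemma sum: "(\<And>i. i < (n::nat) \<Longrightarrow> w i \<in> L1 M) \<Longrightarrow> \<psi> (\<lambda>x. \<Sum>i<n. w i x) = (\<Sum>i<n. \<psi> (w i))"
proof (induction n)
  case (Suc n)
  have "(\<lambda>x. \<Sum>i<n. w i x) \<in> L1 M"
    using Suc.prems by (auto simp: L1_def intro!: Bochner_Integration.integrable_sum)
  with Suc show ?case by (simp add: add)
qed (simp add: zero)

lemma abs_le: "u \<in> L1 M \<Longrightarrow> \<bar>\<psi> u\<bar> \<le> \<psi> (\<lambda>x. \<bar>u x\<bar>)"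
proof -
  assume u: "u \<in> L1 M"
  have "\<psi> u \<le> \<psi> (\<lambda>x. \<bar>u x\<bar>)" "\<psi> (\<lambda>x. - 1 * u x) \<le> \<psi> (\<lambda>x. \<bar>u x\<bar>)"
    using u by (intro mono L1_abs L1_scale; simp add: ae_le_def)+
  then show ?thesis using scale[OF u, of "-1"] by linarith
qed

text \<open>
  Positive functionals on a Banach lattice are automatically bounded.  If \<open>\<psi>\<close> were not, there
  would be nonnegative \<open>w\<^sub>k\<close> with \<open>\<psi> w\<^sub>k = 1\<close> and \<open>L\<^sup>1\<close> norm at most \<open>2\<^sup>-\<^sup>k\<close>.  Their sum \<open>v\<close> is
  integrable and dominates every partial sum, so \<open>\<psi> v\<close> would exceed every natural number.
\<close>

lemma bounded: "\<exists>K\<ge>0. \<forall>u\<in>L1 M. \<bar>\<psi> u\<bar> \<le> K * L1_norm M u"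
proof (rule ccontr)
  assume "\<not> ?thesis"
  then have "\<exists>u\<in>L1 M. 2^k * L1_norm M u < \<bar>\<psi> u\<bar>" for k :: nat
    by (meson not_le zero_le_numeral zero_le_power)
  then have "\<exists>u. \<forall>k. u k \<in> L1 M \<and> 2^k * L1_norm M (u k) < \<bar>\<psi> (u k)\<bar>"
    by (intro choice) auto
  then obtain u where u: "\<And>k. u k \<in> L1 M" and big: "\<And>k. 2^k * L1_norm M (u k) < \<bar>\<psi> (u k)\<bar>"
    by auto
  define t where "t k = \<psi> (\<lambda>x. \<bar>u k x\<bar>)" for k
  have t: "2^k * L1_norm M (u k) < t k" for k
    using big[of k] abs_le[OF u[of k]] by (simp add: t_def)
  have "0 \<le> L1_norm M (u k)" for k by (simp add: L1_norm_def)
  then have t_pos: "0 < t k" for k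
    using le_less_trans[OF mult_nonneg_nonneg t[of k]] by simp
  \<comment> \<open>Passing to \<open>\<bar>u k\<bar>\<close> makes the summands nonnegative everywhere, not just a.e.\<close>
  define w where "w k x = (1 / t k) * \<bar>u k x\<bar>" for k x
  have w: "w k \<in> L1 M" for k
    unfolding w_def[abs_def] by (intro L1_scale L1_abs u)
  have w_pos: "0 \<le> w k x" for k x
    using t_pos[of k] by (simp add: w_def)
  have \<psi>_w: "\<psi> (w k) = 1" for k
    unfolding w_def[abs_def] using t_pos[of k]
    by (subst scale) (auto simp: t_def intro: L1_abs u)
  have int_w: "integral\<^sup>L M (w k) \<le> (1/2)^k" for k
  proof -
    have "integral\<^sup>L M (w k) = L1_norm M (u k) / t k"
      by (simp add: w_def[abs_def] L1_norm_def)
    also have "\<dots> \<le> (1/2)^k"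
      using t[of k] t_pos[of k] by (simp add: field_simps)
    finally show ?thesis .
  qed
  have [measurable]: "w k \<in> borel_measurable M" for k
    using w[of k] by (auto simp: L1_def)
  have nn: "(\<integral>\<^sup>+x. (\<Sum>k. ennreal (w k x)) \<partial>M) < \<infinity>"
  proof -
    have "(\<integral>\<^sup>+x. (\<Sum>k. ennreal (w k x)) \<partial>M) = (\<Sum>k. \<integral>\<^sup>+x. ennreal (w k x) \<partial>M)"
      by (rule nn_integral_suminf) measurable
    also have "\<dots> = (\<Sum>k. ennreal (integral\<^sup>L M (w k)))"
      using w w_pos by (intro suminf_cong nn_integral_eq_integral) (auto simp: L1_def)
    also have "\<dots> \<le> (\<Sum>k. ennreal ((1/2)^k))"
      using int_w by (intro suminf_le ennreal_leI) auto
    also have "\<dots> < \<infinity>"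
      by (subst suminf_ennreal_eq[of _ 2]) (use geometric_sums[of "1/2::real"] in auto)
    finally show ?thesis .
  qed
  then have "AE x in M. (\<Sum>k. ennreal (w k x)) \<noteq> \<infinity>"
    by (intro nn_integral_PInf_AE) auto
  then have sm: "AE x in M. summable (\<lambda>k. w k x)"
    by eventually_elim (auto intro: summable_suminf_not_top w_pos)
  define v where "v x = (\<Sum>k. w k x)" for x
  have [measurable]: "v \<in> borel_measurable M"
    unfolding v_def[abs_def] by measurable
  have v: "v \<in> L1 M"
  proof -
    have "(\<integral>\<^sup>+x. ennreal (norm (v x)) \<partial>M) = (\<integral>\<^sup>+x. (\<Sum>k. ennreal (w k x)) \<partial>M)"
      using sm
      by (intro nn_integral_cong_AE, eventually_elim)
        (auto simp: v_def suminf_nonneg w_pos suminf_ennreal2)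
    with nn show ?thesis by (auto simp: L1_def integrable_iff_bounded)
  qed
  have "real n \<le> \<psi> v" for n
  proof -
    have "(\<Sum>k<n. \<psi> (w k)) = \<psi> (\<lambda>x. \<Sum>k<n. w k x)" by (rule sum[symmetric]) (rule w)
    also have "\<dots> \<le> \<psi> v"
    proof (rule mono[OF _ v])
      show "(\<lambda>x. \<Sum>k<n. w k x) \<in> L1 M"
        using w by (auto simp: L1_def)
      show "ae_le M (\<lambda>x. \<Sum>k<n. w k x) v"
        using sm unfolding ae_le_def
        by eventually_elim (auto simp: v_def intro!: sum_le_suminf w_pos)
    qed
    finally show ?thesis by (simp add: \<psi>_w)
  qed
  moreover obtain n where "\<psi> v < real n" using reals_Archimedean2 by blast
  ultimately show False by (simp add: not_le[symmetric])
qed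

text \<open>
  The duality of \<open>L\<^sup>1\<close> and \<open>L\<^sup>\<infinity>\<close>.  Boundedness makes \<open>E \<mapsto> \<psi> (indicator E)\<close> a finite measure
  dominated by \<open>K\<close> times \<open>M\<close>; its Radon-Nikodym density lies a.e. in \<open>[0, K]\<close> and represents
  \<open>\<psi>\<close> on indicators, hence by linearity and \<open>L\<^sup>1\<close> continuity on all integrable functions.
\<close>

lemma representation: "\<exists>q\<in>Linf M. \<forall>v\<in>L1 M. pairing M q v = \<psi> v"
proof -
  obtain K where K0: "0 \<le> K" and K: "\<And>u. u \<in> L1 M \<Longrightarrow> \<bar>\<psi> u\<bar> \<le> K * L1_norm M u"
    using bounded by blast
  define \<nu> where "\<nu> E = ennreal (\<psi> (indicator E))" for E
  have ind: "indicator E \<in> L1 M" if "E \<in> sets M" for E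
    using that by (auto simp: L1_def integrable_indicator_iff emeasure_eq_measure)
  have \<psi>_ind_nonneg: "0 \<le> \<psi> (indicator E)" if "E \<in> sets M" for E
    using ind[OF that] by (rule nonneg) (simp add: ae_le_def)
  have \<psi>_ind_le: "\<psi> (indicator E) \<le> K * measure M E" if "E \<in> sets M" for E
    using K[OF ind[OF that]] that by (simp add: L1_norm_def)
  have \<psi>_ind_Un: "\<psi> (indicator (E \<union> F)) = \<psi> (indicator E) + \<psi> (indicator F)"
    if "E \<in> sets M" "F \<in> sets M" "E \<inter> F = {}" for E F
  proof -
    have "(indicator (E \<union> F) :: 'a rfun) = (\<lambda>x. indicator E x + indicator F x)"
      using that(3) by (auto simp: indicator_def fun_eq_iff)
    with add[OF ind ind, OF that(1,2)] show ?thesis by simp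
  qed
  have pos: "positive (sets M) \<nu>"
    using zero by (simp add: positive_def \<nu>_def indicator_def[abs_def])
  have ca: "countably_additive (sets M) \<nu>"
  proof (rule sets.empty_continuous_imp_countably_additive[OF pos])
    show "additive (sets M) \<nu>"
      by (auto simp: additive_def \<nu>_def \<psi>_ind_Un \<psi>_ind_nonneg)
    show "\<forall>E\<in>sets M. \<nu> E \<noteq> \<infinity>" by (simp add: \<nu>_def)
  next
    fix E :: "nat \<Rightarrow> 'a set"
    assume E: "range E \<subseteq> sets M" "decseq E" "(\<Inter>i. E i) = {}"
    have "(\<lambda>i. measure M (E i)) \<longlonglongrightarrow> measure M (\<Inter>i. E i)"
      using E by (intro finite_Lim_measure_decseq) auto
    then have lim: "(\<lambda>i. K * measure M (E i)) \<longlonglongrightarrow> 0"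
      using E(3) by (auto intro: tendsto_mult_right_zero)
    have "(\<lambda>i. \<psi> (indicator (E i))) \<longlonglongrightarrow> 0"
      by (rule tendsto_sandwich[OF _ _ tendsto_const lim])
        (use E(1) in \<open>auto intro!: always_eventually \<psi>_ind_nonneg \<psi>_ind_le\<close>)
    then show "(\<lambda>i. \<nu> (E i)) \<longlonglongrightarrow> 0"
      unfolding \<nu>_def using tendsto_ennrealI[of _ 0] by fastforce
  qed
  define N where "N = measure_of (space M) (sets M) \<nu>"
  have sets_N[simp]: "sets N = sets M" by (simp add: N_def)
  have space_N[simp]: "space N = space M" by (simp add: N_def)
  have N: "emeasure N E = \<nu> E" if "E \<in> sets M" for E
    unfolding N_def using sets.sigma_algebra_axioms pos ca that by (rule emeasure_measure_of_sigma)
  have "finite_measure N" by (rule finite_measureI) (simp add: N \<nu>_def)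
  moreover have "absolutely_continuous M N"
    unfolding absolutely_continuous_def null_sets_def
  proof safe
    fix E assume E: "E \<in> sets M" "emeasure M E = 0"
    then show "E \<in> sets N" by simp
    have "\<psi> (indicator E) \<le> 0" using \<psi>_ind_le[OF E(1)] E(2) by (simp add: measure_def)
    then show "emeasure N E = 0" by (simp add: N E \<nu>_def ennreal_neg)
  qed
  ultimately obtain g where [measurable]: "g \<in> borel_measurable M" and g: "density M g = N"
    using Radon_Nikodym_finite_measure[of N] by auto
  have g_int: "(\<integral>\<^sup>+x. g x * indicator E x \<partial>M) = ennreal (\<psi> (indicator E))" if "E \<in> sets M" for E
    using that N[OF that] by (simp add: g[symmetric] emeasure_density \<nu>_def)
  have "(\<integral>\<^sup>+x. g x \<partial>M) = (\<integral>\<^sup>+x. g x * indicator (space M) x \<partial>M)"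
    by (intro nn_integral_cong) simp
  then have g_tot: "(\<integral>\<^sup>+x. g x \<partial>M) \<noteq> \<infinity>" using g_int[OF sets.top] by simp
  then have g_fin: "AE x in M. g x \<noteq> \<infinity>" by (intro nn_integral_PInf_AE) auto
  define h where "h x = enn2real (g x)" for x
  have [measurable]: "h \<in> borel_measurable M" unfolding h_def[abs_def] by measurable
  have h_pos: "0 \<le> h x" for x by (simp add: h_def)
  have hg: "AE x in M. ennreal (h x) = g x"
    using g_fin by eventually_elim (auto simp: h_def less_top)
  have h_nn: "(\<integral>\<^sup>+x. ennreal (h x * indicator E x) \<partial>M) = ennreal (\<psi> (indicator E))"
    if "E \<in> sets M" for E
  proof -
    have "(\<integral>\<^sup>+x. ennreal (h x * indicator E x) \<partial>M) = (\<integral>\<^sup>+x. g x * indicator E x \<partial>M)"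
      using hg by (intro nn_integral_cong_AE, eventually_elim) (auto simp: indicator_def)
    with g_int[OF that] show ?thesis by simp
  qed
  have h_int: "(LINT x|M. h x * indicator E x) = \<psi> (indicator E)"
    and h_integrable: "integrable M (\<lambda>x. h x * indicator E x)" if "E \<in> sets M" for E
    using h_nn[OF that] \<psi>_ind_nonneg[OF that] that h_pos
    by (auto simp: nn_integral_eq_integrable)
  have h_le: "AE x in M. h x \<le> K"
  proof -
    \<comment> \<open>The integral of \<open>h - K\<close> over the set where it is positive is at most zero.\<close>
    define E where "E = {x \<in> space M. K < h x}"
    have E[measurable]: "E \<in> sets M" unfolding E_def by measurable
    have i: "integrable M (\<lambda>x. h x * indicator E x)" "integrable M (\<lambda>x. K * indicator E x)"
      using h_integrable[OF E] ind[OF E] by (auto simp: L1_def)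
    have "(LINT x|M. h x * indicator E x - K * indicator E x) \<le> 0"
      using i h_int[OF E] \<psi>_ind_le[OF E] E by simp
    moreover have *: "0 \<le> h x * indicator E x - K * indicator E x" for x
      by (auto simp: E_def indicator_def)
    ultimately have "(LINT x|M. h x * indicator E x - K * indicator E x) = 0"
      by (intro antisym integral_nonneg_AE) auto
    then have "AE x in M. h x * indicator E x - K * indicator E x = 0"
      using i * by (subst (asm) integral_nonneg_eq_0_iff_AE) auto
    moreover have "AE x in M. x \<in> space M" by (rule AE_space)
    ultimately show ?thesis
      by eventually_elim (auto simp: E_def indicator_def split: if_splits)
  qed
  have h: "h \<in> Linf M"
    using h_le h_pos by (auto simp: Linf_iff_AE_bounded)
  have "pairing M h v = \<psi> v" if "integrable M v" for v
    using that
  proof (induction rule: integrable_induct)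
    case (base E c)
    have "pairing M h (\<lambda>x. c * indicator E x) = (LINT x|M. c * (h x * indicator E x))"
      by (simp add: pairing_def ac_simps)
    also have "\<dots> = c * \<psi> (indicator E)"
      by (subst integral_mult_right_zero) (simp add: h_int[OF base(1)])
    also have "\<dots> = \<psi> (\<lambda>x. c * indicator E x)"
      by (rule scale[symmetric]) (rule ind[OF base(1)])
    finally show ?case by (simp add: mult.commute)
  next
    case (add u v)
    then have L: "u \<in> L1 M" "v \<in> L1 M" by (auto simp: L1_def)
    have "pairing M h (\<lambda>x. u x + v x) = pairing M h u + pairing M h v"
      using L h by (simp add: pairing_def distrib_left integrable_Linf_mult_L1)
    with add L show ?case using positive_L1_functional.add[OF positive_L1_functional_axioms] by simp
  next
    case (lim v s)
    have L: "v \<in> L1 M" "\<And>i. s i \<in> L1 M" using lim by (auto simp: L1_def)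
    have pointwise: "(\<lambda>i. s i x) \<longlonglongrightarrow> v x" and dominated: "\<bar>s i x\<bar> \<le> 2 * \<bar>v x\<bar>"
      if "x \<in> space M" for i x
      using lim that by auto
    have "(\<lambda>i. LINT x|M. \<bar>s i x - v x\<bar>) \<longlonglongrightarrow> (LINT x|M. 0)"
    proof (rule integral_dominated_convergence[where w = "\<lambda>x. 3 * \<bar>v x\<bar>"])
      show "AE x in M. (\<lambda>i. \<bar>s i x - v x\<bar>) \<longlonglongrightarrow> 0"
        using pointwise by (intro AE_I2 tendsto_rabs_zero) (simp add: LIM_zero_iff)
      show "AE x in M. norm \<bar>s i x - v x\<bar> \<le> 3 * \<bar>v x\<bar>" for i
        using dominated[of _ i] by (intro AE_I2) (force simp: abs_real_def split: if_splits)
    qed (use lim in auto)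
    then have n0: "(\<lambda>i. L1_norm M (\<lambda>x. s i x - v x)) \<longlonglongrightarrow> 0" by (simp add: L1_norm_def)
    have cont: "(\<lambda>i. \<theta> (s i)) \<longlonglongrightarrow> \<theta> v"
      if b: "\<And>i. \<bar>\<theta> (s i) - \<theta> v\<bar> \<le> K * L1_norm M (\<lambda>x. s i x - v x)" for \<theta>
    proof -
      have "(\<lambda>i. K * L1_norm M (\<lambda>x. s i x - v x)) \<longlonglongrightarrow> 0"
        using n0 by (rule tendsto_mult_right_zero)
      then have "(\<lambda>i. \<theta> (s i) - \<theta> v) \<longlonglongrightarrow> 0"
        by (rule Lim_null_comparison[rotated]) (use b in simp)
      then show ?thesis by (simp add: LIM_zero_iff)
    qed
    have "(\<lambda>i. \<psi> (s i)) \<longlonglongrightarrow> \<psi> v"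
      using K[OF L1_diff[OF L(2,1)]] diff[OF L(2,1)] by (intro cont) simp
    moreover have "(\<lambda>i. pairing M h (s i)) \<longlonglongrightarrow> pairing M h v"
    proof (rule cont)
      fix i
      have "pairing M h (s i) - pairing M h v = (LINT x|M. h x * (s i x - v x))"
        using L h by (simp add: pairing_def right_diff_distrib integrable_Linf_mult_L1)
      also have "\<bar>\<dots>\<bar> \<le> (LINT x|M. \<bar>h x * (s i x - v x)\<bar>)"
        by (rule integral_abs_bound)
      also have "\<dots> \<le> (LINT x|M. K * \<bar>s i x - v x\<bar>)"
      proof (rule integral_mono_AE)
        show "integrable M (\<lambda>x. \<bar>h x * (s i x - v x)\<bar>)"
          by (intro integrable_abs integrable_Linf_mult_L1 h L1_diff L)
        show "integrable M (\<lambda>x. K * \<bar>s i x - v x\<bar>)" using lim by auto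
        show "AE x in M. \<bar>h x * (s i x - v x)\<bar> \<le> K * \<bar>s i x - v x\<bar>"
          using h_le by eventually_elim (auto simp: abs_mult h_pos intro: mult_right_mono)
      qed
      finally show "\<bar>pairing M h (s i) - pairing M h v\<bar> \<le> K * L1_norm M (\<lambda>x. s i x - v x)"
        by (simp add: L1_norm_def)
    qed
    moreover have "pairing M h (s i) = \<psi> (s i)" for i using lim by blast
    ultimately show ?case using LIMSEQ_unique by simp
  qed
  with h show ?thesis by (auto simp: L1_def)
qed

end

section \<open>Positive elements of the dual of \<open>L\<^sup>\<infinity>\<close>\<close>

locale positive_Linf_functional =
  fixes M :: "'a measure" and \<mu> :: "'a rfun \<Rightarrow> real"
  assumes dual: "\<mu> \<in> Linf_dual M" and dual_nonneg: "dual_nonneg M \<mu>"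
begin

lemma add: "g \<in> Linf M \<Longrightarrow> h \<in> Linf M \<Longrightarrow> \<mu> (\<lambda>x. g x + h x) = \<mu> g + \<mu> h"
  and scale: "g \<in> Linf M \<Longrightarrow> \<mu> (\<lambda>x. c * g x) = c * \<mu> g"
  using dual by (auto simp: Linf_dual_def)

lemma nonneg: "g \<in> Linf M \<Longrightarrow> ae_le M (\<lambda>_. 0) g \<Longrightarrow> 0 \<le> \<mu> g"
  using dual_nonneg by (auto simp: dual_nonneg_def)

lemma diff: "g \<in> Linf M \<Longrightarrow> h \<in> Linf M \<Longrightarrow> \<mu> (g - h) = \<mu> g - \<mu> h"
  using add[of g "\<lambda>x. -1 * h x"] scale[of h "-1"] Linf_scale[of h M "-1"]
  by (simp add: fun_diff_def)

lemma uminus: "g \<in> Linf M \<Longrightarrow> \<mu> (- g) = - \<mu> g"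
  using scale[of g "-1"] by (simp add: fun_Compl_def)

lemma mono:
  assumes "g \<in> Linf M" "h \<in> Linf M" "ae_le M g h"
  shows "\<mu> g \<le> \<mu> h"
proof -
  have "0 \<le> \<mu> (h - g)"
    using assms by (intro nonneg) (auto simp: ae_le_def fun_diff_def intro: Linf_diff)
  then show ?thesis using diff[OF assms(2,1)] by simp
qed

lemma cong_AE:
  assumes "g \<in> Linf M" "h \<in> Linf M" "ae_eq M g h"
  shows "\<mu> g = \<mu> h"
proof (rule antisym)
  have "ae_le M g h" "ae_le M h g"
    using assms(3) unfolding ae_eq_def ae_le_def by (eventually_elim, simp)+
  with assms show "\<mu> g \<le> \<mu> h" "\<mu> h \<le> \<mu> g" by (auto intro: mono)
qed

lemma const: "\<mu> (\<lambda>_. c) = c * \<mu> (\<lambda>_. 1)"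
  using scale[OF Linf_const, of c 1] by simp

lemma abs_le:
  assumes g: "g \<in> Linf M" and C: "AE x in M. \<bar>g x\<bar> \<le> C"
  shows "\<bar>\<mu> g\<bar> \<le> C * \<mu> (\<lambda>_. 1)"
proof -
  have "ae_le M g (\<lambda>_. C)" "ae_le M (\<lambda>_. - C) g"
    using C unfolding ae_le_def by (eventually_elim, simp)+
  then have "\<mu> g \<le> \<mu> (\<lambda>_. C)" "\<mu> (\<lambda>_. - C) \<le> \<mu> g"
    using g by (auto intro!: mono Linf_const)
  then show ?thesis using const[of C] const[of "- C"] by simp
qed

lemma one_nonneg: "0 \<le> \<mu> (\<lambda>_. 1)"
  by (rule nonneg) (auto simp: Linf_const ae_le_def)

text \<open>
  A positive functional attains its norm at the constant one, the greatest element of the unit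
  ball of \<open>L\<^sup>\<infinity>\<close>.
\<close>

lemma dual_norm_eq: "dual_norm M \<mu> = \<mu> (\<lambda>_. 1)"
  unfolding dual_norm_def
proof (rule cSup_eq_maximum)
  have "Linf_norm M (\<lambda>_. 1) \<le> 1" by (rule Linf_norm_le) auto
  then have "(\<lambda>_. 1) \<in> {\<psi> \<in> Linf M. Linf_norm M \<psi> \<le> 1}" by (simp add: Linf_const)
  with one_nonneg show "\<mu> (\<lambda>_. 1) \<in> (\<lambda>\<psi>. \<bar>\<mu> \<psi>\<bar>) ` {\<psi> \<in> Linf M. Linf_norm M \<psi> \<le> 1}"
    by (intro image_eqI[of _ _ "\<lambda>_. 1"]) auto
next
  fix r assume "r \<in> (\<lambda>\<psi>. \<bar>\<mu> \<psi>\<bar>) ` {\<psi> \<in> Linf M. Linf_norm M \<psi> \<le> 1}"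
  then obtain g where g: "r = \<bar>\<mu> g\<bar>" "g \<in> Linf M" "Linf_norm M g \<le> 1" by auto
  have "AE x in M. \<bar>g x\<bar> \<le> 1"
    using AE_abs_le_Linf_norm[OF g(2)] g(3) by (auto elim: eventually_mono)
  with g show "r \<le> \<mu> (\<lambda>_. 1)" using abs_le[of g 1] by simp
qed

text \<open>
  Pulling a positive functional back along a positive operator gives a functional to which the
  representation theorem applies.
\<close>

lemma positive_L1_functional_compose:
  assumes "finite_measure M" and P: "positive_op M P"
  shows "positive_L1_functional M (\<lambda>u. \<mu> (P u))"
proof -
  interpret finite_measure M by fact
  have Linf: "P u \<in> Linf M" if "u \<in> L1 M" for u
    using P that by (auto simp: positive_op_def linear_op_def)
  show ?thesis
  proof
    fix u v :: "'a rfun" and c :: real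
    assume u: "u \<in> L1 M"
    have "\<mu> (P (\<lambda>x. c * u x)) = \<mu> (\<lambda>x. c * P u x)"
      using P u by (intro cong_AE Linf Linf_scale L1_scale) (auto simp: positive_op_def linear_op_def)
    with u show "\<mu> (P (\<lambda>x. c * u x)) = c * \<mu> (P u)"
      by (simp add: scale Linf)
    show "0 \<le> \<mu> (P u)" if "ae_le M (\<lambda>_. 0) u"
      using P u that by (intro nonneg Linf) (auto simp: positive_op_def)
    assume v: "v \<in> L1 M"
    have "\<mu> (P (\<lambda>x. u x + v x)) = \<mu> (\<lambda>x. P u x + P v x)"
      using P u v by (intro cong_AE Linf Linf_add L1_add) (auto simp: positive_op_def linear_op_def)
    with u v show "\<mu> (P (\<lambda>x. u x + v x)) = \<mu> (P u) + \<mu> (P v)"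
      by (simp add: add Linf)
  qed
qed

end

locale positive_dual_pair =
  one: positive_Linf_functional M "fst \<nu>" + two: positive_Linf_functional M "snd \<nu>"
  for M :: "'a measure" and \<nu> :: "'a dual_pair"
begin

lemma norm_eq: "dual_pair_norm M \<nu> = fst \<nu> (\<lambda>_. 1) + snd \<nu> (\<lambda>_. 1)"
  by (simp add: dual_pair_norm_def one.dual_norm_eq two.dual_norm_eq)

lemma norm_nonneg: "0 \<le> dual_pair_norm M \<nu>"
  using one.one_nonneg two.one_nonneg by (simp add: norm_eq)

lemma pairing_diff:
  "\<phi> \<in> Linf M \<times> Linf M \<Longrightarrow> \<psi> \<in> Linf M \<times> Linf M \<Longrightarrow>
    dual_pairing \<nu> (\<phi> - \<psi>) = dual_pairing \<nu> \<phi> - dual_pairing \<nu> \<psi>"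
  by (auto simp: dual_pairing_def one.diff two.diff)

lemma pairing_uminus:
  "\<phi> \<in> Linf M \<times> Linf M \<Longrightarrow> dual_pairing \<nu> (- \<phi>) = - dual_pairing \<nu> \<phi>"
  by (auto simp: dual_pairing_def one.uminus two.uminus)

lemma pairing_mono:
  "\<phi> \<in> Linf M \<times> Linf M \<Longrightarrow> \<psi> \<in> Linf M \<times> Linf M \<Longrightarrow> ae_pair_le M \<phi> \<psi> \<Longrightarrow>
    dual_pairing \<nu> \<phi> \<le> dual_pairing \<nu> \<psi>"
  by (auto simp: dual_pairing_def ae_pair_le_def intro!: add_mono one.mono two.mono)

lemma pairing_const: "dual_pairing \<nu> (\<lambda>_. c, \<lambda>_. c) = c * dual_pair_norm M \<nu>"
  by (simp add: dual_pairing_def norm_eq one.const[of c] two.const[of c] distrib_left)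

lemma abs_pairing_le:
  assumes "\<phi> \<in> Linf M \<times> Linf M"
  shows "\<bar>dual_pairing \<nu> \<phi>\<bar> \<le> Linf_pair_norm M \<phi> * dual_pair_norm M \<nu>"
proof -
  have "AE x in M. \<bar>fst \<phi> x\<bar> \<le> Linf_pair_norm M \<phi>" "AE x in M. \<bar>snd \<phi> x\<bar> \<le> Linf_pair_norm M \<phi>"
    using assms
    by (auto simp: Linf_pair_norm_def
        intro: eventually_mono[OF AE_abs_le_Linf_norm[of "fst \<phi>" M]]
          eventually_mono[OF AE_abs_le_Linf_norm[of "snd \<phi>" M]])
  then have "\<bar>fst \<nu> (fst \<phi>)\<bar> \<le> Linf_pair_norm M \<phi> * fst \<nu> (\<lambda>_. 1)"
    "\<bar>snd \<nu> (snd \<phi>)\<bar> \<le> Linf_pair_norm M \<phi> * snd \<nu> (\<lambda>_. 1)"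
    using assms by (auto intro!: one.abs_le two.abs_le)
  then show ?thesis by (simp add: dual_pairing_def norm_eq distrib_left)
qed

end

lemma positive_dual_pair_iff:
  "positive_dual_pair M \<nu> \<longleftrightarrow> \<nu> \<in> Linf_dual_pair M \<and> dual_pair_nonneg M \<nu>"
  by (cases \<nu>) (auto simp: positive_dual_pair_def positive_Linf_functional_def
      Linf_dual_pair_def dual_pair_nonneg_def)

definition scale_dual :: "real \<Rightarrow> 'a dual_pair \<Rightarrow> 'a dual_pair" where
  "scale_dual c \<nu> = (\<lambda>g. c * fst \<nu> g, \<lambda>g. c * snd \<nu> g)"

lemma dual_pairing_scale_dual: "dual_pairing (scale_dual c \<nu>) \<phi> = c * dual_pairing \<nu> \<phi>"
  by (simp add: dual_pairing_def scale_dual_def distrib_left)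

lemma Linf_dual_scale:
  assumes "\<mu> \<in> Linf_dual M"
  shows "(\<lambda>g. c * \<mu> g) \<in> Linf_dual M"
proof -
  from assms obtain K where K: "\<And>g. g \<in> Linf M \<Longrightarrow> \<bar>\<mu> g\<bar> \<le> K * Linf_norm M g"
    unfolding Linf_dual_def by blast
  have "\<bar>c * \<mu> g\<bar> \<le> (\<bar>c\<bar> * K) * Linf_norm M g" if "g \<in> Linf M" for g
    using mult_left_mono[OF K[OF that], of "\<bar>c\<bar>"] by (simp add: abs_mult mult.assoc)
  with assms show ?thesis
    by (auto simp: Linf_dual_def distrib_left)
qed

lemma positive_dual_pair_scale_dual:
  assumes "positive_dual_pair M \<nu>" "0 \<le> c"
  shows "positive_dual_pair M (scale_dual c \<nu>)"
  using assms
  by (auto simp: positive_dual_pair_def positive_Linf_functional_def scale_dual_def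
      dual_nonneg_def Linf_dual_scale)

section \<open>Regular operators and their adjoints\<close>

lemma linear_op_Linf: "linear_op M S \<Longrightarrow> u \<in> L1 M \<Longrightarrow> S u \<in> Linf M"
  by (simp add: linear_op_def)

lemma linear_op_add:
  assumes S: "linear_op M S" and T: "linear_op M T"
  shows "linear_op M (\<lambda>u x. S u x + T u x)"
  unfolding linear_op_def
proof (intro conjI ballI allI impI)
  fix u v :: "'a rfun" and c :: real
  assume u: "u \<in> L1 M"
  show "(\<lambda>x. S u x + T u x) \<in> Linf M"
    using u S T by (auto simp: linear_op_def intro: Linf_add)
  have "ae_eq M (S (\<lambda>x. c * u x)) (\<lambda>x. c * S u x)" "ae_eq M (T (\<lambda>x. c * u x)) (\<lambda>x. c * T u x)"
    using u S T by (auto simp: linear_op_def)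
  then show "ae_eq M (\<lambda>y. S (\<lambda>x. c * u x) y + T (\<lambda>x. c * u x) y) (\<lambda>x. c * (S u x + T u x))"
    unfolding ae_eq_def by eventually_elim (simp add: distrib_left)
  assume v: "v \<in> L1 M"
  have "ae_eq M (S (\<lambda>x. u x + v x)) (\<lambda>x. S u x + S v x)"
    "ae_eq M (T (\<lambda>x. u x + v x)) (\<lambda>x. T u x + T v x)"
    using u v S T by (auto simp: linear_op_def)
  then show "ae_eq M (\<lambda>y. S (\<lambda>x. u x + v x) y + T (\<lambda>x. u x + v x) y)
    (\<lambda>x. (S u x + T u x) + (S v x + T v x))"
    unfolding ae_eq_def by eventually_elim simp
  assume "ae_eq M u v"
  then have "ae_eq M (S u) (S v)" "ae_eq M (T u) (T v)"
    using u v S T by (auto simp: linear_op_def)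
  then show "ae_eq M (\<lambda>x. S u x + T u x) (\<lambda>x. S v x + T v x)"
    unfolding ae_eq_def by eventually_elim simp
qed

lemma linear_op_uminus:
  assumes S: "linear_op M S"
  shows "linear_op M (\<lambda>u. - S u)"
  unfolding linear_op_def
proof (intro conjI ballI allI impI)
  fix u v :: "'a rfun" and c :: real
  assume u: "u \<in> L1 M"
  show "- S u \<in> Linf M"
    using u S by (auto simp: linear_op_def fun_Compl_def intro: Linf_uminus)
  have "ae_eq M (S (\<lambda>x. c * u x)) (\<lambda>x. c * S u x)"
    using u S by (auto simp: linear_op_def)
  then show "ae_eq M (- S (\<lambda>x. c * u x)) (\<lambda>x. c * (- S u) x)"
    unfolding ae_eq_def by eventually_elim simp
  assume v: "v \<in> L1 M"
  have "ae_eq M (S (\<lambda>x. u x + v x)) (\<lambda>x. S u x + S v x)"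
    using u v S by (auto simp: linear_op_def)
  then show "ae_eq M (- S (\<lambda>x. u x + v x)) (\<lambda>x. (- S u) x + (- S v) x)"
    unfolding ae_eq_def by eventually_elim simp
  assume "ae_eq M u v"
  then have "ae_eq M (S u) (S v)"
    using u v S by (auto simp: linear_op_def)
  then show "ae_eq M (- S u) (- S v)"
    unfolding ae_eq_def by eventually_elim simp
qed

lemma positive_op_diff:
  assumes "linear_op M S" "linear_op M T" "op_le M T S"
  shows "positive_op M (\<lambda>u. S u - T u)"
proof -
  have "linear_op M (\<lambda>u x. S u x + (- T u) x)"
    by (intro linear_op_add linear_op_uminus assms)
  then have "linear_op M (\<lambda>u. S u - T u)"
    by (simp add: fun_diff_def fun_Compl_def)
  then show ?thesis
    using assms(3) by (auto simp: positive_op_def op_le_def)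
qed

lemma positive_op_add:
  assumes "positive_op M S" "positive_op M T"
  shows "positive_op M (\<lambda>u x. S u x + T u x)"
  unfolding positive_op_def
proof (intro conjI ballI impI)
  show "linear_op M (\<lambda>u x. S u x + T u x)"
    using assms by (intro linear_op_add) (auto simp: positive_op_def)
  fix u assume "u \<in> L1 M" "ae_le M (\<lambda>_. 0) u"
  then have "ae_le M (\<lambda>_. 0) (S u)" "ae_le M (\<lambda>_. 0) (T u)"
    using assms by (auto simp: positive_op_def)
  then show "ae_le M (\<lambda>_. 0) (\<lambda>x. S u x + T u x)"
    unfolding ae_le_def by eventually_elim simp
qed

text \<open>
  If \<open>T = P - Q\<close> and \<open>T \<le> S\<close>, then \<open>S = ((S - T) + P) - Q\<close> is a difference of positive
  operators.  Thus the exact operator inherits regularity from any of its lower bounds.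
\<close>

lemma regular_op_above:
  assumes S: "linear_op M S" and T: "regular_op M T" and le: "op_le M T S"
  shows "regular_op M S"
proof -
  from T obtain P Q where T': "linear_op M T" and PQ: "positive_op M P" "positive_op M Q"
    and eq: "\<And>u. u \<in> L1 M \<Longrightarrow> ae_eq M (T u) (P u - Q u)"
    by (auto simp: regular_op_def)
  have "positive_op M (\<lambda>u x. (S u - T u) x + P u x)"
    by (intro positive_op_add positive_op_diff S T' le PQ)
  moreover have "ae_eq M (S u) ((\<lambda>x. (S u - T u) x + P u x) - Q u)" if "u \<in> L1 M" for u
    using eq[OF that] unfolding ae_eq_def by eventually_elim simp
  ultimately show ?thesis
    using S PQ(2) unfolding regular_op_def by blast
qed

lemma (in positive_Linf_functional) regular_op_representation:
  assumes "finite_measure M" "regular_op M S"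
  shows "\<exists>q\<in>Linf M. \<forall>v\<in>L1 M. pairing M q v = \<mu> (S v)"
proof -
  from assms obtain P Q where S: "linear_op M S" and PQ: "positive_op M P" "positive_op M Q"
    and eq: "\<And>u. u \<in> L1 M \<Longrightarrow> ae_eq M (S u) (P u - Q u)"
    by (auto simp: regular_op_def)
  obtain p q where p: "p \<in> Linf M" "\<And>v. v \<in> L1 M \<Longrightarrow> pairing M p v = \<mu> (P v)"
    and q: "q \<in> Linf M" "\<And>v. v \<in> L1 M \<Longrightarrow> pairing M q v = \<mu> (Q v)"
    using positive_L1_functional.representation[OF positive_L1_functional_compose] assms(1) PQ
    by meson
  have "pairing M (\<lambda>x. p x - q x) v = \<mu> (S v)" if v: "v \<in> L1 M" for v
  proof -
    have L: "P v \<in> Linf M" "Q v \<in> Linf M" "S v \<in> Linf M"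
      using PQ S v by (auto simp: positive_op_def linear_op_Linf)
    have "\<mu> (S v) = \<mu> (P v - Q v)"
      using eq[OF v] L by (intro cong_AE) (auto simp: fun_diff_def intro: Linf_diff)
    with v p q L show ?thesis by (simp add: pairing_diff_left diff)
  qed
  then show ?thesis using Linf_diff[OF p(1) q(1)] by blast
qed

lemma constraint_op_Linf:
  "linear_op M S \<Longrightarrow> linear_op M T \<Longrightarrow> u \<in> L1 M \<Longrightarrow> constraint_op S T u \<in> Linf M \<times> Linf M"
  by (auto simp: constraint_op_def fun_Compl_def intro: Linf_uminus linear_op_Linf)

lemma constraint_data_Linf:
  "g \<in> Linf M \<Longrightarrow> h \<in> Linf M \<Longrightarrow> constraint_data g h \<in> Linf M \<times> Linf M"
  by (auto simp: constraint_data_def fun_Compl_def intro: Linf_uminus)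

text \<open>
  The adjoint is a Hilbert choice, so its defining property has to be earned by exhibiting a
  representing function.
\<close>

lemma (in positive_dual_pair) adjoint_op:
  assumes "finite_measure M" "regular_op M S" "regular_op M T"
  shows adjoint_op_Linf: "adjoint_op M (constraint_op S T) \<nu> \<in> Linf M"
    and pairing_adjoint_op: "v \<in> L1 M \<Longrightarrow>
      pairing M (adjoint_op M (constraint_op S T) \<nu>) v = dual_pairing \<nu> (constraint_op S T v)"
proof -
  obtain p q where p: "p \<in> Linf M" "\<And>v. v \<in> L1 M \<Longrightarrow> pairing M p v = fst \<nu> (S v)"
    and q: "q \<in> Linf M" "\<And>v. v \<in> L1 M \<Longrightarrow> pairing M q v = snd \<nu> (T v)"
    using one.regular_op_representation[OF assms(1,2)] two.regular_op_representation[OF assms(1,3)]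
    by blast
  have "pairing M (\<lambda>x. p x - q x) v = dual_pairing \<nu> (constraint_op S T v)" if v: "v \<in> L1 M" for v
    using v p q assms(3)
    by (simp add: pairing_diff_left dual_pairing_def constraint_op_def two.uminus
        linear_op_Linf regular_op_def)
  then have "\<exists>q. q \<in> Linf M \<and>
      (\<forall>v\<in>L1 M. pairing M q v = dual_pairing \<nu> (constraint_op S T v))"
    using Linf_diff[OF p(1) q(1)] by blast
  from someI_ex[OF this]
  show "adjoint_op M (constraint_op S T) \<nu> \<in> Linf M"
    and "v \<in> L1 M \<Longrightarrow>
      pairing M (adjoint_op M (constraint_op S T) \<nu>) v = dual_pairing \<nu> (constraint_op S T v)"
    by (auto simp: adjoint_op_def)
qed

section \<open>Bounds for solutions of the dual problem\<close>

text \<open>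
  Testing with \<open>q = (r / 2) * sgn v\<close>, which lies in the ball of radius \<open>r\<close> around \<open>0\<close>, turns the
  interior point condition into a lower bound for \<open>J\<close> by a multiple of the \<open>L\<^sup>1\<close> norm.
\<close>

lemma coercive_of_interior:
  assumes "Linf_interior_point M (subdiff M J (\<lambda>_. 0)) (\<lambda>_. 0)"
  obtains s where "0 < s" "\<And>v. v \<in> L1 M \<Longrightarrow> ereal (s * L1_norm M v) \<le> J v"
proof -
  obtain r where r: "0 < r" and ball: "\<And>q. q \<in> Linf M \<Longrightarrow> Linf_norm M q < r \<Longrightarrow> q \<in> subdiff M J (\<lambda>_. 0)"
    using assms by (auto simp: Linf_interior_point_def fun_diff_def)
  show ?thesis
  proof (rule that[of "r / 2"])
    show "0 < r / 2" using r by simp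
    fix v assume v: "v \<in> L1 M"
    then have [measurable]: "v \<in> borel_measurable M" by (auto simp: L1_def)
    define q where "q x = (r / 2) * sgn (v x)" for x
    have [measurable]: "q \<in> borel_measurable M"
      unfolding q_def[abs_def] by measurable
    have b: "\<bar>q x\<bar> \<le> r / 2" for x
      using r by (auto simp: q_def abs_mult abs_sgn_eq)
    have "Linf_norm M q \<le> r / 2"
      using b r by (intro Linf_norm_le) auto
    moreover have "q \<in> Linf M"
      unfolding Linf_iff_AE_bounded using b by (intro conjI exI[of _ "r / 2"]) simp_all
    ultimately have "q \<in> subdiff M J (\<lambda>_. 0)"
      using ball r by simp
    then have "ereal (pairing M q v) \<le> J v"
      using v by (simp add: subdiff_def)
    moreover have "pairing M q v = r / 2 * L1_norm M v"
    proof -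
      have "q x * v x = r / 2 * \<bar>v x\<bar>" for x
        by (simp add: q_def sgn_if abs_if)
      then have "pairing M q v = (LINT x|M. r / 2 * \<bar>v x\<bar>)"
        by (simp only: pairing_def)
      then show ?thesis by (simp only: L1_norm_def integral_mult_right_zero)
    qed
    ultimately show "ereal (r / 2 * L1_norm M v) \<le> J v" by simp
  qed
qed

text \<open>
  The operator norm controls only the unit ball.  Linear operators are homogeneous only
  up to null sets, so homogeneity of \<open>S\<close> is asked for after pairing with \<open>\<nu>\<close>.
  To avoid dividing by a norm that may be zero, \<open>v\<close> is divided by numbers \<open>t\<close> slightly larger than its norm.
\<close>

lemma (in positive_dual_pair) abs_pairing_op_le:
  fixes S :: "'a rfun \<Rightarrow> 'a rfun \<times> 'a rfun"
  assumes norm: "op_norm M (Linf_pair_norm M) S \<le> ereal \<eta>" and \<eta>: "0 \<le> \<eta>"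
    and Linf: "\<And>u. u \<in> L1 M \<Longrightarrow> S u \<in> Linf M \<times> Linf M"
    and hom: "\<And>c u. u \<in> L1 M \<Longrightarrow> dual_pairing \<nu> (S (\<lambda>x. c * u x)) = c * dual_pairing \<nu> (S u)"
    and v: "v \<in> L1 M"
  shows "\<bar>dual_pairing \<nu> (S v)\<bar> \<le> \<eta> * dual_pair_norm M \<nu> * L1_norm M v"
proof -
  have unit: "\<bar>dual_pairing \<nu> (S u)\<bar> \<le> \<eta> * dual_pair_norm M \<nu>"
    if u: "u \<in> L1 M" "L1_norm M u \<le> 1" for u
  proof -
    have "ereal (Linf_pair_norm M (S u)) \<le> op_norm M (Linf_pair_norm M) S"
      unfolding op_norm_def using u by (intro SUP_upper) simp
    with norm have "Linf_pair_norm M (S u) \<le> \<eta>"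
      using order_trans by fastforce
    then show ?thesis
      using abs_pairing_le[OF Linf[OF u(1)]] norm_nonneg mult_right_mono order_trans by blast
  qed
  have "\<bar>dual_pairing \<nu> (S v)\<bar> \<le> \<eta> * dual_pair_norm M \<nu> * t" if t: "L1_norm M v < t" for t
  proof -
    have "0 \<le> L1_norm M v" by (simp add: L1_norm_def)
    with t have t_pos: "0 < t" by simp
    have "L1_norm M (\<lambda>x. (1 / t) * v x) = L1_norm M v / t"
      using t_pos by (simp add: L1_norm_def abs_mult)
    also have "\<dots> \<le> 1" using t t_pos by simp
    finally have "\<bar>dual_pairing \<nu> (S (\<lambda>x. (1 / t) * v x))\<bar> \<le> \<eta> * dual_pair_norm M \<nu>"
      by (intro unit L1_scale v)
    then have "\<bar>dual_pairing \<nu> (S v)\<bar> / t \<le> \<eta> * dual_pair_norm M \<nu>"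
      using t_pos by (subst (asm) hom[OF v]) (simp add: abs_mult)
    then show ?thesis using t_pos by (simp add: divide_le_eq)
  qed
  then have le: "\<bar>dual_pairing \<nu> (S v)\<bar> \<le> \<eta> * dual_pair_norm M \<nu> * (L1_norm M v + e)" if "0 < e" for e
    using that by simp
  show ?thesis
  proof (rule field_le_epsilon)
    fix e :: real assume e: "0 < e"
    \<comment> \<open>\<open>k + 1\<close> instead of \<open>k\<close> in the denominator because \<open>k\<close> may be zero.\<close>
    define k where "k = \<eta> * dual_pair_norm M \<nu>"
    have k: "0 \<le> k" using \<eta> norm_nonneg by (simp add: k_def)
    have "\<bar>dual_pairing \<nu> (S v)\<bar> \<le> k * (L1_norm M v + e / (k + 1))"
      using le[of "e / (k + 1)"] e k by (simp add: k_def)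
    also have "\<dots> \<le> k * L1_norm M v + e"
    proof -
      have "k * e \<le> e * (k + 1)" using e by (simp add: algebra_simps)
      then have "k * (e / (k + 1)) \<le> e" using k by (simp add: divide_le_eq)
      then show ?thesis by (simp add: distrib_left)
    qed
    finally show "\<bar>dual_pairing \<nu> (S v)\<bar> \<le> \<eta> * dual_pair_norm M \<nu> * L1_norm M v + e"
      by (simp add: k_def)
  qed
qed

text \<open>
  Replacing the exact operator by its approximation may move \<open>- B\<^sup>* \<nu>\<close> out of the set of
  subgradients, upwards, and adding some \<open>\<lambda> \<ge> 0\<close> only moves it further up.
  Shrinking \<open>\<nu>\<close> by a factor \<open>c\<close>
  compensates for this: \<open>- B\<^sup>* (c \<nu>)\<close> is \<open>c\<close> times an exact subgradient plus \<open>c\<close>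
  times a perturbation of size \<open>\<eta> \<parallel>\<nu>\<parallel>\<close>, and the room of \<open>1 - c\<close> times the ball of radius \<open>s\<close> absorbs the latter
  exactly when \<open>c \<eta> \<parallel>\<nu>\<parallel> \<le> (1 - c) s\<close>.  The largest such \<open>c\<close> is chosen.
\<close>

lemma (in positive_dual_pair) scale_dual_feasible:
  fixes \<eta> s :: real
  defines "c \<equiv> s / (s + \<eta> * dual_pair_norm M \<nu>)"
  assumes M: "finite_measure M"
    and S: "regular_op M S" and T: "regular_op M T" and A: "regular_op M A"
    and le: "op_le M S A" "op_le M A T"
    and norm: "op_norm M (Linf_pair_norm M) (\<lambda>u. constraint_op A A u - constraint_op S T u) \<le> ereal \<eta>"
      and \<eta>: "0 \<le> \<eta>"
    and s: "0 < s" and coercive: "\<And>v. v \<in> L1 M \<Longrightarrow> ereal (s * L1_norm M v) \<le> J v"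
    and J0: "J (\<lambda>_. 0) = 0"
    and src: "\<And>v. v \<in> L1 M \<Longrightarrow> ereal (- dual_pairing \<nu> (constraint_op A A v)) \<le> J v"
  shows "(\<lambda>_. 0, scale_dual c \<nu>) \<in> dual_feasible M J (constraint_op S T)"
proof -
  define \<kappa> where "\<kappa> = dual_pair_norm M \<nu>"
  have \<kappa>: "0 \<le> \<kappa>" using norm_nonneg by (simp add: \<kappa>_def)
  have den: "0 < s + \<eta> * \<kappa>" using s \<eta> \<kappa> by (simp add: add_pos_nonneg)
  have c: "0 \<le> c" "c \<le> 1" "c * (\<eta> * \<kappa>) = (1 - c) * s"
    using s \<eta> \<kappa> den unfolding c_def \<kappa>_def[symmetric] by (auto simp: field_simps)
  have lin: "linear_op M A" "linear_op M S" "linear_op M T"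
    using A S T by (auto simp: regular_op_def)
  have pos: "positive_dual_pair M \<nu>" by unfold_locales
  interpret c: positive_dual_pair M "scale_dual c \<nu>"
    using pos c(1) by (rule positive_dual_pair_scale_dual)
  let ?D = "\<lambda>u. constraint_op A A u - constraint_op S T u"
  have D: "dual_pairing \<nu> (?D u)
      = dual_pairing \<nu> (constraint_op A A u) - dual_pairing \<nu> (constraint_op S T u)"
    if "u \<in> L1 M" for u
    using that by (intro pairing_diff constraint_op_Linf lin)
  have hom: "dual_pairing \<nu> (constraint_op P Q (\<lambda>x. a * u x)) = a * dual_pairing \<nu> (constraint_op P Q u)"
    if u: "u \<in> L1 M" and P: "linear_op M P" and Q: "linear_op M Q" for P Q a u
  proof -
    have "fst \<nu> (P (\<lambda>x. a * u x)) = fst \<nu> (\<lambda>x. a * P u x)"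
      using P u by (intro one.cong_AE linear_op_Linf L1_scale Linf_scale) (auto simp: linear_op_def)
    moreover have "snd \<nu> (Q (\<lambda>x. a * u x)) = snd \<nu> (\<lambda>x. a * Q u x)"
      using Q u by (intro two.cong_AE linear_op_Linf L1_scale Linf_scale) (auto simp: linear_op_def)
    ultimately show ?thesis
      using u P Q by (simp add: dual_pairing_def constraint_op_def two.uminus one.scale two.scale
          linear_op_Linf L1_scale right_diff_distrib)
  qed
  have perturb: "\<bar>dual_pairing \<nu> (?D v)\<bar> \<le> \<eta> * \<kappa> * L1_norm M v" if v: "v \<in> L1 M" for v
    unfolding \<kappa>_def
  proof (rule abs_pairing_op_le[OF norm \<eta> _ _ v])
    show "?D u \<in> Linf M \<times> Linf M" if "u \<in> L1 M" for u
      using constraint_op_Linf[OF lin(1,1) that] constraint_op_Linf[OF lin(2,3) that]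
      by (auto simp: mem_Times_iff fun_diff_def intro: Linf_diff)
    show "dual_pairing \<nu> (?D (\<lambda>x. a * u x)) = a * dual_pairing \<nu> (?D u)" if "u \<in> L1 M" for a u
      using that by (simp add: D L1_scale hom lin right_diff_distrib)
  qed
  let ?q = "(\<lambda>_. 0) - adjoint_op M (constraint_op S T) (scale_dual c \<nu>)"
  note adj = c.adjoint_op[OF M S T]
  have q: "?q \<in> Linf M"
    unfolding fun_diff_def by (intro Linf_diff Linf_const adj)
  have q_eq: "pairing M ?q v = c * (- dual_pairing \<nu> (constraint_op A A v)) + c * dual_pairing \<nu> (?D v)"
    if v: "v \<in> L1 M" for v
  proof -
    have "pairing M ?q v = - c * dual_pairing \<nu> (constraint_op S T v)"
      using v adj
      by (simp add: fun_diff_def pairing_diff_left Linf_const dual_pairing_scale_dual)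
        (simp add: pairing_def)
    then show ?thesis by (simp add: D v algebra_simps)
  qed
  have "ereal (pairing M ?q v) \<le> J v" if v: "v \<in> L1 M" for v
  proof (cases "J v")
    case (real j)
    have "- dual_pairing \<nu> (constraint_op A A v) \<le> j" "s * L1_norm M v \<le> j"
      using src[OF v] coercive[OF v] real by auto
    then have "c * (- dual_pairing \<nu> (constraint_op A A v)) \<le> c * j"
      "(1 - c) * (s * L1_norm M v) \<le> (1 - c) * j"
      using c(1,2) mult_left_mono diff_ge_0_iff_ge by blast+
    moreover have "c * dual_pairing \<nu> (?D v) \<le> (1 - c) * (s * L1_norm M v)"
    proof -
      have "c * dual_pairing \<nu> (?D v) \<le> c * (\<eta> * \<kappa> * L1_norm M v)"
        using perturb[OF v] c(1) by (intro mult_left_mono) auto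
      also have "\<dots> = (c * (\<eta> * \<kappa>)) * L1_norm M v" by simp
      also have "\<dots> = (1 - c) * (s * L1_norm M v)" by (simp only: c(3) mult.assoc)
      finally show ?thesis .
    qed
    ultimately have "pairing M ?q v \<le> c * j + (1 - c) * j"
      unfolding q_eq[OF v] by linarith
    then show ?thesis using real by (simp add: algebra_simps)
  next
    case PInf
    then show ?thesis by simp
  next
    case MInf
    then show ?thesis using coercive[OF v] by simp
  qed
  moreover have "J (\<lambda>_. 0) = ereal (pairing M ?q (\<lambda>_. 0))"
    using J0 by (simp add: pairing_def)
  ultimately have "?q \<in> subdiff M J (\<lambda>_. 0)" using q by (simp add: subdiff_def)
  moreover have "scale_dual c \<nu> \<in> Linf_dual_pair M" "dual_pair_nonneg M (scale_dual c \<nu>)"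
    using c.positive_dual_pair_axioms by (auto simp: positive_dual_pair_iff)
  ultimately show ?thesis
    by (simp add: dual_feasible_def Linf_const ae_le_def)
qed

text \<open>
  Both dual objectives are compared with \<open>j\<close>, the value of \<open>J\<close> at the exact solution \<open>u\<close>.  The source
  element satisfies \<open>(\<nu>, \<phi>) \<le> - j + C0 \<epsilon> \<parallel>\<nu>\<parallel>\<close>; every feasible \<open>\<mu>\<close> satisfies
  \<open>- j + \<epsilon> \<parallel>\<mu>\<parallel> \<le> (\<mu>, \<phi>)\<close>, because \<open>u\<close> is feasible for the relaxed constraints with a
  margin \<open>\<epsilon>\<close>.  Optimality of \<open>\<mu>\<close> against the competitor \<open>c \<nu>\<close> leaves
  \<open>\<epsilon> \<parallel>\<mu>\<parallel> \<le> (1 - c) j + c C0 \<epsilon> \<parallel>\<nu>\<parallel>\<close>, where \<open>1 - c \<le> \<eta> \<parallel>\<nu>\<parallel> / s\<close>.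
\<close>

lemma dual_solution_norm_le:
  fixes \<epsilon> \<eta> s j C0 :: real
  assumes M: "finite_measure M"
    and S: "regular_op M S" and T: "regular_op M T" and A: "regular_op M A"
    and le: "op_le M S A" "op_le M A T"
    and norm: "op_norm M (Linf_pair_norm M) (\<lambda>u. constraint_op A A u - constraint_op S T u) \<le> ereal \<eta>"
      and \<eta>: "0 \<le> \<eta>"
    and data: "f \<in> Linf M" "g \<in> Linf M" "h \<in> Linf M"
    and rate: "ae_pair_le M (\<lambda>_. \<epsilon>, \<lambda>_. \<epsilon>) (constraint_data g h - constraint_data f f)"
      "ae_pair_le M (constraint_data g h - constraint_data f f) (\<lambda>_. C0 * \<epsilon>, \<lambda>_. C0 * \<epsilon>)"
      and \<epsilon>: "0 < \<epsilon>" and C0: "0 \<le> C0"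
    and s: "0 < s" and coercive: "\<And>v. v \<in> L1 M \<Longrightarrow> ereal (s * L1_norm M v) \<le> J v"
    and J0: "J (\<lambda>_. 0) = 0"
    and u: "u \<in> nonneg_solutions M A f" and Ju: "J u = ereal j"
    and \<nu>: "\<nu> \<in> Linf_dual_pair M" "dual_pair_nonneg M \<nu>"
    and source: "- adjoint_op M (constraint_op A A) \<nu> \<in> subdiff M J u"
    and sol: "dual_solution M J (constraint_op S T) (constraint_data g h) l \<mu>"
  shows "dual_pair_norm M \<mu> \<le> (C0 + j / s * (\<eta> / \<epsilon>)) * dual_pair_norm M \<nu>"
proof -
  define \<kappa> c where "\<kappa> = dual_pair_norm M \<nu>" and "c = s / (s + \<eta> * dual_pair_norm M \<nu>)"
  let ?\<phi> = "constraint_data g h" and ?\<phi>' = "constraint_data f f"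
  have feas: "l \<in> Linf M" "ae_le M (\<lambda>_. 0) l" "\<mu> \<in> Linf_dual_pair M" "dual_pair_nonneg M \<mu>"
    "l - adjoint_op M (constraint_op S T) \<mu> \<in> subdiff M J (\<lambda>_. 0)"
    using sol by (auto simp: dual_solution_def dual_feasible_def)
  interpret \<mu>: positive_dual_pair M \<mu> using feas by (simp add: positive_dual_pair_iff)
  interpret \<nu>: positive_dual_pair M \<nu> using \<nu> by (simp add: positive_dual_pair_iff)
  have u': "u \<in> L1 M" "ae_le M (\<lambda>_. 0) u" "ae_eq M (A u) f"
    using u by (auto simp: nonneg_solutions_def)
  have lin: "linear_op M A" "linear_op M S" "linear_op M T"
    using A S T by (auto simp: regular_op_def)
  have \<phi>: "?\<phi> \<in> Linf M \<times> Linf M" "?\<phi>' \<in> Linf M \<times> Linf M"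
    using data by (auto intro: constraint_data_Linf)
  have \<phi>_diff: "?\<phi> - ?\<phi>' \<in> Linf M \<times> Linf M"
    using \<phi> by (auto simp: mem_Times_iff fun_diff_def intro: Linf_diff)
  have const: "(\<lambda>_. a, \<lambda>_. a) \<in> Linf M \<times> Linf M" for a :: real
    by (simp add: Linf_const)
  have exact: "dual_pairing \<rho> (constraint_op A A u) = dual_pairing \<rho> ?\<phi>'"
    if "positive_dual_pair M \<rho>" for \<rho>
  proof -
    interpret \<rho>: positive_dual_pair M \<rho> by fact
    have Au: "A u \<in> Linf M" using lin(1) u'(1) by (rule linear_op_Linf)
    have "fst \<rho> (A u) = fst \<rho> f" "snd \<rho> (A u) = snd \<rho> f"
      using \<rho>.one.cong_AE[OF Au data(1) u'(3)] \<rho>.two.cong_AE[OF Au data(1) u'(3)] .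
    then show ?thesis
      using Au data(1)
      by (simp add: dual_pairing_def constraint_op_def constraint_data_def \<rho>.two.uminus)
  qed
  have source_pairing: "pairing M (- adjoint_op M (constraint_op A A) \<nu>) v
      = - dual_pairing \<nu> (constraint_op A A v)" if "v \<in> L1 M" for v
    using \<nu>.pairing_adjoint_op[OF M A A that] by (simp add: pairing_def)
  have j: "dual_pairing \<nu> ?\<phi>' = - j"
    using source source_pairing[OF u'(1)] Ju exact[OF \<nu>.positive_dual_pair_axioms]
    by (simp add: subdiff_def)
  have j_nonneg: "0 \<le> j"
  proof -
    have "0 \<le> s * L1_norm M u" using s by (simp add: L1_norm_def)
    then show ?thesis using coercive[OF u'(1)] Ju by simp
  qed
  have competitor: "(\<lambda>_. 0, scale_dual c \<nu>) \<in> dual_feasible M J (constraint_op S T)"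
    unfolding c_def
    using source source_pairing
    by (intro \<nu>.scale_dual_feasible[OF M S T A le norm \<eta> s coercive J0])
      (auto simp: subdiff_def)
  have optimal: "dual_pairing \<mu> ?\<phi> \<le> c * dual_pairing \<nu> ?\<phi>"
    using sol competitor \<mu>.pairing_uminus[OF \<phi>(1)] \<nu>.pairing_uminus[OF \<phi>(1)]
    by (auto simp: dual_solution_def dual_pairing_scale_dual)
  have upper: "dual_pairing \<nu> ?\<phi> \<le> - j + C0 * \<epsilon> * \<kappa>"
    using \<nu>.pairing_mono[OF \<phi>_diff const rate(2)] \<nu>.pairing_diff[OF \<phi>] j
    by (simp add: \<nu>.pairing_const \<kappa>_def)
  have lower: "- j + \<epsilon> * dual_pair_norm M \<mu> \<le> dual_pairing \<mu> ?\<phi>"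
  proof -
    have "- j \<le> dual_pairing \<mu> (constraint_op S T u)"
    proof -
      have "pairing M (l - adjoint_op M (constraint_op S T) \<mu>) u \<le> j"
        using feas(5) u'(1) Ju by (auto simp: subdiff_def)
      moreover have "pairing M (l - adjoint_op M (constraint_op S T) \<mu>) u
          = pairing M l u - dual_pairing \<mu> (constraint_op S T u)"
        using \<mu>.adjoint_op[OF M S T] u'(1) feas(1) by (simp add: fun_diff_def pairing_diff_left)
      moreover have "0 \<le> pairing M l u"
        unfolding pairing_def
      proof (rule integral_nonneg_AE)
        show "AE x in M. 0 \<le> l x * u x"
          using feas(2) u'(2) unfolding ae_le_def by eventually_elim simp
      qed
      ultimately show ?thesis by linarith
    qed
    \<comment> \<open>\<open>u \<ge> 0\<close> turns the operator bounds \<open>S \<le> A \<le> T\<close> into pointwise ones.\<close>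
    also have "\<dots> \<le> dual_pairing \<mu> (constraint_op A A u)"
    proof (rule \<mu>.pairing_mono)
      have "ae_le M (\<lambda>_. 0) (A u - S u)" "ae_le M (\<lambda>_. 0) (T u - A u)"
        using le u' by (auto simp: op_le_def)
      then show "ae_pair_le M (constraint_op S T u) (constraint_op A A u)"
        by (simp add: ae_pair_le_def ae_le_def constraint_op_def)
    qed (intro constraint_op_Linf lin u')+
    also have "\<dots> = dual_pairing \<mu> ?\<phi>'" by (rule exact) unfold_locales
    finally show ?thesis
      using \<mu>.pairing_mono[OF const \<phi>_diff rate(1)] \<mu>.pairing_diff[OF \<phi>]
      by (simp add: \<mu>.pairing_const)
  qed
  have \<kappa>: "0 \<le> \<kappa>" using \<nu>.norm_nonneg by (simp add: \<kappa>_def)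
  have den: "0 < s + \<eta> * \<kappa>" using s \<eta> \<kappa> by (simp add: add_pos_nonneg)
  have c: "0 \<le> c" "c \<le> 1"
    using s \<eta> \<kappa> den unfolding c_def \<kappa>_def[symmetric] by (auto simp: divide_le_eq)
  have "c * (s + \<eta> * \<kappa>) = s"
    using den by (simp add: c_def \<kappa>_def)
  then have c_eq: "1 - c = c * (\<eta> * \<kappa>) / s"
    using s by (simp add: eq_divide_eq algebra_simps)
  have c1: "1 - c \<le> \<eta> * \<kappa> / s"
    unfolding c_eq using c(1,2) s \<eta> \<kappa> by (intro divide_right_mono mult_left_le_one_le) auto
  have "- j + \<epsilon> * dual_pair_norm M \<mu> \<le> c * (- j + C0 * \<epsilon> * \<kappa>)"
    using lower optimal mult_left_mono[OF upper c(1)] by linarith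
  then have "\<epsilon> * dual_pair_norm M \<mu> \<le> (1 - c) * j + c * (C0 * \<epsilon> * \<kappa>)"
    by (simp add: algebra_simps)
  also have "\<dots> \<le> (\<eta> * \<kappa> / s) * j + C0 * \<epsilon> * \<kappa>"
    using c1 c j_nonneg C0 \<epsilon> \<kappa> by (intro add_mono mult_right_mono mult_left_le_one_le) auto
  also have "\<dots> = \<epsilon> * ((C0 + j / s * (\<eta> / \<epsilon>)) * \<kappa>)"
    using \<epsilon> by (simp add: field_simps)
  finally show ?thesis using \<epsilon> by (simp add: \<kappa>_def)
qed

lemma bounded_above_of_limsup:
  fixes x :: "nat \<Rightarrow> real"
  assumes "limsup (\<lambda>n. ereal (x n)) \<le> ereal D"
  obtains R where "0 \<le> R" "\<And>n. x n \<le> R"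
proof -
  have "limsup (\<lambda>n. ereal (x n)) < ereal (D + 1)"
    using assms by (rule le_less_trans) simp
  then have "eventually (\<lambda>n. x n < D + 1) sequentially"
    by (auto dest: Limsup_lessD)
  then obtain N where N: "\<And>n. N \<le> n \<Longrightarrow> x n < D + 1"
    by (auto simp: eventually_sequentially)
  define R where "R = max 0 (max (D + 1) (Max (x ` {..N})))"
  have "x n \<le> R" for n
  proof (cases "n \<le> N")
    case True
    then have "x n \<le> Max (x ` {..N})" by simp
    then show ?thesis by (simp add: R_def)
  qed (use N[of n] in \<open>simp add: R_def\<close>)
  then show ?thesis using that[of R] by (simp add: R_def)
qed

theorem theorem11:
  fixes \<Omega> :: "(real ^ 'm) set"
    and M :: "(real ^ 'm) measure"
    and A :: "(real ^ 'm) rfun \<Rightarrow> (real ^ 'm) rfun"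
    and Al Au :: "nat \<Rightarrow> (real ^ 'm) rfun \<Rightarrow> (real ^ 'm) rfun"
    and f :: "(real ^ 'm) rfun"
    and fl fu :: "nat \<Rightarrow> (real ^ 'm) rfun"
    and J :: "(real ^ 'm) rfun \<Rightarrow> ereal"
    and ubar :: "(real ^ 'm) rfun"
    and \<epsilon> \<eta> :: "nat \<Rightarrow> real"
    and C0 D0 :: real
    and \<mu>bar :: "(real ^ 'm) dual_pair"
    and lam :: "nat \<Rightarrow> (real ^ 'm) rfun"
    and \<mu> :: "nat \<Rightarrow> (real ^ 'm) dual_pair"
  assumes domain: "open \<Omega>" "connected \<Omega>" "\<Omega> \<noteq> {}" "bounded \<Omega>"
    and M: "M = lebesgue_on \<Omega>"
    \<comment> \<open>exact and approximate operators and data\<close>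
    and A: "linear_op M A"
    and A_bounds_regular: "\<And>n. regular_op M (Al n)" "\<And>n. regular_op M (Au n)"
    and f: "f \<in> Linf M"
    and f_bounds_Linf: "\<And>n. fl n \<in> Linf M" "\<And>n. fu n \<in> Linf M"
    and f_bounds: "\<And>n. ae_le M (fl n) f" "\<And>n. ae_le M f (fu n)"
    and f_monotone: "\<And>n. ae_le M (fl n) (fl (Suc n))" "\<And>n. ae_le M (fu (Suc n)) (fu n)"
    and A_bounds: "\<And>n. op_le M (Al n) A" "\<And>n. op_le M A (Au n)"
    and A_monotone: "\<And>n. op_le M (Al n) (Al (Suc n))" "\<And>n. op_le M (Au (Suc n)) (Au n)"
    and f_conv: "(\<lambda>n. Linf_norm M (fu n - fl n)) \<longlonglongrightarrow> 0"
    and A_conv: "(\<lambda>n. op_norm M (Linf_norm M) (\<lambda>u. Au n u - Al n u)) \<longlonglongrightarrow> 0"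
    \<comment> \<open>regularisation functional and \<open>J\<close>-minimising solution\<close>
    and J: "L1_functional M J" "convex_functional M J" "proper_functional M J"
      "abs_one_homogeneous M J"
    and solvable: "\<exists>u\<in>nonneg_solutions M A f. J u < \<infinity>"
    and ubar: "J_minimising_solution M A f J ubar"
    \<comment> \<open>convergence assumption\<close>
    and eps: "\<And>n. 0 < \<epsilon> n" "decseq \<epsilon>" "\<epsilon> \<longlonglongrightarrow> 0"
    and eta: "decseq \<eta>" "\<eta> \<longlonglongrightarrow> 0"
    and C0_D0: "1 \<le> C0" "0 < D0"
    and data_rate:
      "\<And>n. ae_pair_le M (\<lambda>_. \<epsilon> n, \<lambda>_. \<epsilon> n) (constraint_data (fl n) (fu n) - constraint_data f f)"
      "\<And>n. ae_pair_le M (constraint_data (fl n) (fu n) - constraint_data f f)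
              (\<lambda>_. C0 * \<epsilon> n, \<lambda>_. C0 * \<epsilon> n)"
    and op_rate:
      "\<And>n. op_norm M (Linf_pair_norm M)
              (\<lambda>u. constraint_op A A u - constraint_op (Al n) (Au n) u) \<le> ereal (\<eta> n)"
    and ratio: "limsup (\<lambda>n. ereal (\<eta> n / \<epsilon> n)) \<le> ereal D0"
    \<comment> \<open>source condition\<close>
    and source: "\<mu>bar \<in> Linf_dual_pair M" "dual_pair_nonneg M \<mu>bar"
      "- adjoint_op M (constraint_op A A) \<mu>bar \<in> subdiff M J ubar"
    \<comment> \<open>non-empty interior assumption\<close>
    and interior: "Linf_interior_point M (subdiff M J (\<lambda>_. 0)) (\<lambda>_. 0)"
    \<comment> \<open>dual solutions\<close>
    and dual: "\<And>n. dual_solution M J (constraint_op (Al n) (Au n)) (constraint_data (fl n) (fu n))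
                    (lam n) (\<mu> n)"
  shows "\<exists>C\<ge>C0. \<forall>n. dual_pair_norm M (\<mu> n) \<le> C * dual_pair_norm M \<mu>bar"
proof -
  have M_fin: "finite_measure M"
    unfolding M using domain by (intro finite_measure_lebesgue_on lmeasurable_open)
  have A_regular: "regular_op M A"
    using A A_bounds_regular(1) A_bounds(1) by (rule regular_op_above)
  have J0: "J (\<lambda>_. 0) = 0"
  proof -
    have zero: "(\<lambda>_. 0) \<in> L1 M" by (simp add: L1_def)
    from J(4)[unfolded abs_one_homogeneous_def, THEN bspec, OF zero, THEN spec, of 0]
    show ?thesis by (simp flip: zero_ereal_def)
  qed
  obtain s where s: "0 < s" "\<And>v. v \<in> L1 M \<Longrightarrow> ereal (s * L1_norm M v) \<le> J v"
    using coercive_of_interior[OF interior] by blast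
  obtain R where R: "0 \<le> R" "\<And>n. \<eta> n / \<epsilon> n \<le> R"
    using bounded_above_of_limsup[OF ratio] by blast
  have \<eta>_nonneg: "0 \<le> \<eta> n" for n
    using decseq_ge[OF eta] .
  have u: "ubar \<in> nonneg_solutions M A f"
    using ubar by (simp add: J_minimising_solution_def)
  obtain j where j: "J ubar = ereal j"
    using source(3) by (auto simp: subdiff_def)
  have j_nonneg: "0 \<le> j"
    using J(1) u j by (auto simp: L1_functional_def nonneg_solutions_def)
  interpret \<mu>bar: positive_dual_pair M \<mu>bar
    using source by (simp add: positive_dual_pair_iff)
  have "dual_pair_norm M (\<mu> n) \<le> (C0 + j / s * R) * dual_pair_norm M \<mu>bar" for n
  proof -
    have "dual_pair_norm M (\<mu> n) \<le> (C0 + j / s * (\<eta> n / \<epsilon> n)) * dual_pair_norm M \<mu>bar"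
      using C0_D0
      by (intro dual_solution_norm_le[OF M_fin A_bounds_regular A_regular A_bounds op_rate \<eta>_nonneg
            f f_bounds_Linf data_rate eps(1) _ s J0 u j source dual]) simp
    also have "\<dots> \<le> (C0 + j / s * R) * dual_pair_norm M \<mu>bar"
      using R(2) j_nonneg s(1) \<mu>bar.norm_nonneg
      by (intro mult_right_mono add_left_mono mult_left_mono) auto
    finally show ?thesis .
  qed
  moreover have "C0 \<le> C0 + j / s * R"
    using j_nonneg s(1) R(1) by simp
  ultimately show ?thesis by blast
qed

end
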